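(* Let $\mathcal G$ be a finite connected compact metric graph with length vector $\ell\in(0,\infty)^{\mathcal E}$, Kirchhoff conditions at interior vertices and a fixed Dirichlet or Neumann condition at each exterior vertex, and let $\omega$ be a nonempty open subset of the disjoint union of the edge interiors. Assume that GGCC fails and let $K\subsetneq\mathcal G$ be a proper primitive subgraph with $K\cap\omega=\varnothing$ satisfying $\operatorname{RAC}(K,\ell)$, i.e. $H_\ell\cap\mathcal R_K\neq\varnothing$. Assume $r_\ell=\dim H_\ell\ge2$ and that the intrinsic flow of $\ell$ is $(\gamma,\tau)$-Diophantine for some $\gamma>0$, $\tau>r_\ell-1$. Then there exist constants $C,c>0$ and frequencies $k_n\to\infty$ with $\Lambda_n:=k_n^2$ eigenvalues of $-\Delta_{\mathcal G,\ell}$ such that for every $T>0$ and every $n$ $$\mathfrak o_T(\Lambda_n)\le C\,T\,\Lambda_n^{-1/\tau},$$ equivalently (interpreting the inverse as $+\infty$ at zero) $$\mathfrak o_T(\Lambda_n)^{-1}\ge c\,T^{-1}\Lambda_n^{1/\tau}.$$ Here $$\mathfrak o_T(\Lambda):=\inf\Big\{\int_0^T\|e^{it\Delta_{\mathcal G,\ell}}z_0\|_{L^2(\omega)}^2\,dt:\ z_0\in\mathbf 1_{[0,\Lambda]}(-\Delta_{\mathcal G,\ell})L^2(\mathcal G),\ \|z_0\|_{L^2(\mathcal G)}=1\Big\}.$$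
   Context: Setting. $\mathcal G=(\mathcal V,\mathcal E,\ell)$: finite connected graph (loops and parallel edges allowed), each edge $e$ identified with $[0,\ell_e]$, $\ell_e>0$. A vertex is exterior if it has degree one (loops count twice), interior otherwise. $L^2(\mathcal G)=\bigoplus_{e}L^2(0,\ell_e)$. $-\Delta_{\mathcal G,\ell}$ is the self-adjoint operator acting as $-u''$ on each edge, on edgewise $H^2$ functions that at each interior vertex are continuous and have vanishing sum of normal derivatives (Kirchhoff), and at each exterior vertex $v$ satisfy the fixed prescribed condition, $u(v)=0$ (Dirichlet) or $\partial_\nu u(v)=0$ (Neumann). A loop is a one-edge simple cycle, and two parallel edges may form a two-edge simple cycle. A primitive subgraph is a simple cycle or a simple path joining two exterior vertices; it is proper if it is not all of $\mathcal G$. GGCC (Graph Geometric Control Condition): every simple cycle of $\mathcal G$ and every simple path of $\mathcal G$ joining two exterior vertices meets $\omega$. Secular objects. $\mathbb T=\mathbb R/2\pi\mathbb Z$. Let $\mathcal B$ be the set of directed bonds (each edge $e$ gives two, $(e,+)$ and $(e,-)$, reverses of each other). Let $S_B$ be the unitary matrix on $\mathbb C^{\mathcal B}$ with $(S_Ba)_b=\sum_{b'}\sigma_{bb'}a_{b'}$, the sum over bonds $b'$ ending at the initial vertex $v$ of $b$; if $v$ is interior of degree $d$, $\sigma_{bb'}=2/d-1$ if $b'$ is the reverse of $b$ and $2/d$ otherwise; if $v$ is exterior, $\sigma_{bb'}=-1$ (Dirichlet) or $+1$ (Neumann). For $\theta\in\mathbb T^{\mathcal E}$, $D(\theta)$ is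 the diagonal matrix with entry $e^{i\theta_e}$ on both bonds of $e$, and $U_B(\theta)=D(\theta)S_B$. Set $I_e(a)=|a_{e,+}|^2+|a_{e,-}|^2$ and $Z_B=\{\theta\in\mathbb T^{\mathcal E}:\det(I-U_B(\theta))=0\}$. For a proper primitive $K$, $\mathcal R_K\subset Z_B$ is the set of $\theta$ for which $1$ is a simple eigenvalue of $U_B(\theta)$ and its eigenvector $a$ is supported exactly on $K$ ($I_e(a)>0$ iff $e\subset K$). Arithmetic. $H_\ell=\overline{\{[k\ell]:k\in\mathbb R\}}\subset\mathbb T^{\mathcal E}$, a subtorus of dimension $r_\ell$. Choose a Lie-group isomorphism $\Xi:\mathbb T^{r_\ell}\to H_\ell$ induced by integral lattice coordinates and $\beta\in\mathbb R^{r_\ell}$ with $\Xi([t\beta])=[t\ell]$ for all $t$. With $\widehat\beta=\beta/\|\beta\|$, the intrinsic flow is $(\gamma,\tau)$-Diophantine if $|q\cdot\widehat\beta|\ge\gamma\|q\|^{-\tau}$ for every $q\in\mathbb Z^{r_\ell}\setminus\{0\}$, where $\tau>r_\ell-1$. *)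

theory Defs
  imports "HOL-Analysis.Analysis"
begin

section \<open>Finite graphs and their primitive subgraphs\<close>

text \<open>
  The vertex set and the edge set are the universes of two finite types, so loops and parallel
  edges are allowed. Edge \<open>e\<close> of length \<open>l $ e\<close> is parametrised by \<open>[0, l $ e]\<close>, with \<open>0\<close> at
  \<open>src e\<close> and \<open>l $ e\<close> at \<open>tgt e\<close>. The value of \<open>bc\<close> matters at exterior vertices only.
\<close>

datatype bcond = Dirichlet | Neumann

record ('v, 'e) qgraph =
  src :: "'e \<Rightarrow> 'v"
  tgt :: "'e \<Rightarrow> 'v"
  bc :: "'v \<Rightarrow> bcond"

text \<open>The directed bond \<open>(e, True)\<close> is \<open>(e, +)\<close>, running from \<open>src e\<close> to \<open>tgt e\<close>;
  \<open>(e, False)\<close> is \<open>(e, -)\<close>.\<close>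

type_synonym 'e bond = "'e \<times> bool"

definition bond_start :: "('v, 'e) qgraph \<Rightarrow> 'e bond \<Rightarrow> 'v" where
  "bond_start G b = (if snd b then src G (fst b) else tgt G (fst b))"

definition bond_end :: "('v, 'e) qgraph \<Rightarrow> 'e bond \<Rightarrow> 'v" where
  "bond_end G b = (if snd b then tgt G (fst b) else src G (fst b))"

definition bond_reverse :: "'e bond \<Rightarrow> 'e bond" where
  "bond_reverse b = (fst b, \<not> snd b)"

text \<open>The edge ends at \<open>v\<close> correspond to the bonds starting at \<open>v\<close>, so a loop counts twice.\<close>

definition degree :: "('v, 'e::finite) qgraph \<Rightarrow> 'v \<Rightarrow> nat" where
  "degree G v = card {b. bond_start G b = v}"

definition exterior :: "('v, 'e::finite) qgraph \<Rightarrow> 'v \<Rightarrow> bool" where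
  "exterior G v \<longleftrightarrow> degree G v = 1"

definition graph_connected :: "('v, 'e) qgraph \<Rightarrow> bool" where
  "graph_connected G \<longleftrightarrow> (\<forall>u v. (u, v) \<in> {(bond_start G b, bond_end G b) | b. True}\<^sup>*)"

definition bond_walk :: "('v, 'e) qgraph \<Rightarrow> 'e bond list \<Rightarrow> bool" where
  "bond_walk G bs \<longleftrightarrow> bs \<noteq> [] \<and> successively (\<lambda>b b'. bond_end G b = bond_start G b') bs"

text \<open>Cycles and paths are identified with their edge sets. Distinctness of the edges excludes
  the back-and-forth walk along one edge, but admits two-edge cycles made of parallel edges.\<close>

definition simple_cycle :: "('v, 'e) qgraph \<Rightarrow> 'e set \<Rightarrow> bool" where
  "simple_cycle G K \<longleftrightarrow> (\<exists>bs. bond_walk G bs \<and> bond_end G (last bs) = bond_start G (hd bs) \<and>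
     distinct (map (bond_start G) bs) \<and> distinct (map fst bs) \<and> K = fst ` set bs)"

definition simple_exterior_path :: "('v, 'e::finite) qgraph \<Rightarrow> 'e set \<Rightarrow> bool" where
  "simple_exterior_path G K \<longleftrightarrow> (\<exists>bs. bond_walk G bs \<and>
     distinct (bond_start G (hd bs) # map (bond_end G) bs) \<and>
     exterior G (bond_start G (hd bs)) \<and> exterior G (bond_end G (last bs)) \<and> K = fst ` set bs)"

definition primitive_subgraph :: "('v, 'e::finite) qgraph \<Rightarrow> 'e set \<Rightarrow> bool" where
  "primitive_subgraph G K \<longleftrightarrow> simple_cycle G K \<or> simple_exterior_path G K"

definition proper_primitive_subgraph :: "('v, 'e::finite) qgraph \<Rightarrow> 'e set \<Rightarrow> bool" where
  "proper_primitive_subgraph G K \<longleftrightarrow> primitive_subgraph G K \<and> K \<noteq> UNIV"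

text \<open>A subset \<open>\<omega>\<close> of the disjoint union of the edge interiors is the family of its traces
  \<open>\<omega> e\<close> on the edges; it misses a subgraph with edge set \<open>K\<close> iff \<open>\<omega> e\<close> is empty
  for all \<open>e \<in> K\<close>.\<close>

definition open_in_edges :: "real ^ 'e \<Rightarrow> ('e \<Rightarrow> real set) \<Rightarrow> bool" where
  "open_in_edges l \<omega> \<longleftrightarrow> (\<forall>e. open (\<omega> e) \<and> \<omega> e \<subseteq> {0<..<l $ e})"

definition meets :: "'e set \<Rightarrow> ('e \<Rightarrow> real set) \<Rightarrow> bool" where
  "meets K \<omega> \<longleftrightarrow> (\<exists>e\<in>K. \<omega> e \<noteq> {})"

definition GGCC :: "('v, 'e::finite) qgraph \<Rightarrow> ('e \<Rightarrow> real set) \<Rightarrow> bool" where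
  "GGCC G \<omega> \<longleftrightarrow> (\<forall>K. simple_cycle G K \<or> simple_exterior_path G K \<longrightarrow> meets K \<omega>)"

section \<open>The Laplacian on the metric graph\<close>

text \<open>Elements of \<open>L\<^sup>2\<close> are handled through representatives \<open>u e x\<close>, of which only the restriction
  to \<open>0 < x < l $ e\<close>, up to null sets, is relevant.\<close>

type_synonym 'e gfun = "'e \<Rightarrow> real \<Rightarrow> complex"

definition L2 :: "real ^ 'e \<Rightarrow> 'e gfun set" where
  "L2 l = {u. \<forall>e. set_borel_measurable lborel {0<..<l $ e} (u e) \<and>
     set_integrable lborel {0<..<l $ e} (\<lambda>x. (cmod (u e x))\<^sup>2)}"

definition L2_inner :: "real ^ 'e::finite \<Rightarrow> 'e gfun \<Rightarrow> 'e gfun \<Rightarrow> complex" where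
  "L2_inner l u v = (\<Sum>e\<in>UNIV. LINT x:{0<..<l $ e}|lborel. u e x * cnj (v e x))"

definition L2_norm :: "real ^ 'e::finite \<Rightarrow> 'e gfun \<Rightarrow> real" where
  "L2_norm l u = sqrt (\<Sum>e\<in>UNIV. LINT x:{0<..<l $ e}|lborel. (cmod (u e x))\<^sup>2)"

text \<open>Value and outward normal derivative at the end of an edge where the bond \<open>b\<close> starts.\<close>

definition end_value :: "real ^ 'e \<Rightarrow> 'e gfun \<Rightarrow> 'e bond \<Rightarrow> complex" where
  "end_value l u b = (if snd b then u (fst b) 0 else u (fst b) (l $ fst b))"

definition end_normal :: "real ^ 'e \<Rightarrow> 'e gfun \<Rightarrow> 'e bond \<Rightarrow> complex" where
  "end_normal l du b = (if snd b then - du (fst b) 0 else du (fst b) (l $ fst b))"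

definition vertex_conditions ::
    "('v, 'e::finite) qgraph \<Rightarrow> real ^ 'e \<Rightarrow> 'e gfun \<Rightarrow> 'e gfun \<Rightarrow> bool" where
  "vertex_conditions G l u du \<longleftrightarrow> (\<forall>v.
     if exterior G v
     then (\<forall>b. bond_start G b = v \<longrightarrow>
       (case bc G v of Dirichlet \<Rightarrow> end_value l u b = 0 | Neumann \<Rightarrow> end_normal l du b = 0))
     else (\<forall>b b'. bond_start G b = v \<and> bond_start G b' = v \<longrightarrow> end_value l u b = end_value l u b') \<and>
       (\<Sum>b | bond_start G b = v. end_normal l du b) = 0)"

text \<open>
  Graph of the operator: \<open>u\<close> is in the domain and \<open>w\<close> represents \<open>- u''\<close>. A function is in
  \<open>H\<^sup>2(0, L)\<close> iff it has a representative that is \<open>C\<^sup>1\<close> on \<open>[0, L]\<close> and whose derivative is an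
  indefinite integral of an \<open>L\<^sup>2\<close> function; elements of the domain are given by this
  representative, which the vertex conditions need anyway.
\<close>

definition neg_laplacian ::
    "('v, 'e::finite) qgraph \<Rightarrow> real ^ 'e \<Rightarrow> 'e gfun \<Rightarrow> 'e gfun \<Rightarrow> bool" where
  "neg_laplacian G l u w \<longleftrightarrow> w \<in> L2 l \<and> (\<exists>du.
     (\<forall>e. \<forall>x\<in>{0..l $ e}.
        (u e has_vector_derivative du e x) (at x within {0..l $ e}) \<and>
        du e x = du e 0 - (LINT y:{0<..<x}|lborel. w e y)) \<and>
     vertex_conditions G l u du)"

definition eigenspace :: "('v, 'e::finite) qgraph \<Rightarrow> real ^ 'e \<Rightarrow> real \<Rightarrow> 'e gfun set" where
  "eigenspace G l \<mu> = {u. neg_laplacian G l u (\<lambda>e x. of_real \<mu> * u e x)}"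

definition eigenvalues :: "('v, 'e::finite) qgraph \<Rightarrow> real ^ 'e \<Rightarrow> real set" where
  "eigenvalues G l = {\<mu>. \<exists>u\<in>eigenspace G l \<mu>. L2_norm l u \<noteq> 0}"

definition eigenprojection ::
    "('v, 'e::finite) qgraph \<Rightarrow> real ^ 'e \<Rightarrow> real \<Rightarrow> 'e gfun \<Rightarrow> 'e gfun \<Rightarrow> bool" where
  "eigenprojection G l \<mu> u w \<longleftrightarrow> w \<in> eigenspace G l \<mu> \<and>
     (\<forall>\<phi>\<in>eigenspace G l \<mu>. L2_inner l (\<lambda>e x. u e x - w e x) \<phi> = 0)"

text \<open>
  Functional calculus of the negative Laplacian \<open>A\<close>: \<open>v\<close> represents \<open>f(A) u\<close>. Since \<open>A\<close> is
  self-adjoint with compact resolvent, its spectral measure is the sum of the orthogonal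
  projections \<open>\<Pi>\<^sub>\<mu>\<close> onto its eigenspaces, and \<open>f(A) u\<close> is the sum over the
  eigenvalues of \<open>f(\<mu>) \<Pi>\<^sub>\<mu> u\<close>, converging in \<open>L\<^sup>2\<close>. It is unique up to null sets.
\<close>

definition spectral_calculus ::
    "('v, 'e::finite) qgraph \<Rightarrow> real ^ 'e \<Rightarrow> (real \<Rightarrow> complex) \<Rightarrow> 'e gfun \<Rightarrow> 'e gfun \<Rightarrow> bool" where
  "spectral_calculus G l f u v \<longleftrightarrow> u \<in> L2 l \<and> v \<in> L2 l \<and>
     (\<exists>p. (\<forall>\<mu>. eigenprojection G l \<mu> u (p \<mu>)) \<and>
       ((\<lambda>F. L2_norm l (\<lambda>e x. v e x - (\<Sum>\<mu>\<in>F. f \<mu> * p \<mu> e x))) \<longlongrightarrow> 0)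
         (finite_subsets_at_top (eigenvalues G l)))"

definition spectral_subspace :: "('v, 'e::finite) qgraph \<Rightarrow> real ^ 'e \<Rightarrow> real \<Rightarrow> 'e gfun set" where
  "spectral_subspace G l \<Lambda> = {z. \<exists>u\<in>L2 l. spectral_calculus G l (indicator {0..\<Lambda>}) u z}"

text \<open>\<open>z t\<close> represents \<open>exp(i t \<Delta>) z0\<close>, i.e. \<open>exp(- i t A) z0\<close> with \<open>A = - \<Delta>\<close>.\<close>

definition schroedinger_evolution ::
    "('v, 'e::finite) qgraph \<Rightarrow> real ^ 'e \<Rightarrow> 'e gfun \<Rightarrow> (real \<Rightarrow> 'e gfun) \<Rightarrow> bool" where
  "schroedinger_evolution G l z0 z \<longleftrightarrow> (\<forall>t. spectral_calculus G l (\<lambda>\<mu>. cis (- (t * \<mu>))) z0 (z t))"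

definition observed_energy :: "('e::finite \<Rightarrow> real set) \<Rightarrow> 'e gfun \<Rightarrow> ennreal" where
  "observed_energy \<omega> u = (\<Sum>e\<in>UNIV. \<integral>\<^sup>+x\<in>\<omega> e. ennreal ((cmod (u e x))\<^sup>2) \<partial>lborel)"

text \<open>The infimum is taken in \<open>[0, \<infinity>]\<close>; in particular it is \<open>\<infinity>\<close> if the spectral subspace is
  trivial. The observed energy does not depend on the representatives \<open>z t\<close>.\<close>

definition observability_constant ::
    "('v, 'e::finite) qgraph \<Rightarrow> real ^ 'e \<Rightarrow> ('e \<Rightarrow> real set) \<Rightarrow> real \<Rightarrow> real \<Rightarrow> ennreal" where
  "observability_constant G l \<omega> T \<Lambda> = Inf {\<integral>\<^sup>+t\<in>{0..T}. observed_energy \<omega> (z t) \<partial>lborel | z0 z.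
     z0 \<in> spectral_subspace G l \<Lambda> \<and> L2_norm l z0 = 1 \<and> schroedinger_evolution G l z0 z}"

section \<open>Secular objects\<close>

text \<open>\<open>\<real>/2\<pi>\<int>\<close> is realised as the unit circle through the isomorphism \<open>[\<theta>] \<mapsto> exp(i \<theta>)\<close>; the group
  operation on tori is the componentwise multiplication of vectors.\<close>

definition torus :: "(complex ^ 'n) set" where
  "torus = {z. \<forall>i. cmod (z $ i) = 1}"

definition torus_class :: "real ^ 'n \<Rightarrow> complex ^ 'n" where
  "torus_class x = (\<chi> i. cis (x $ i))"

definition bond_scattering :: "('v, 'e::finite) qgraph \<Rightarrow> complex ^ 'e bond ^ 'e bond" where
  "bond_scattering G = (\<chi> b b'.
     if bond_end G b' = bond_start G b then
       (if exterior G (bond_start G b)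
        then (case bc G (bond_start G b) of Dirichlet \<Rightarrow> -1 | Neumann \<Rightarrow> 1)
        else if b' = bond_reverse b then 2 / of_nat (degree G (bond_start G b)) - 1
        else 2 / of_nat (degree G (bond_start G b)))
     else 0)"

definition bond_phases :: "complex ^ 'e::finite \<Rightarrow> complex ^ 'e bond ^ 'e bond" where
  "bond_phases \<theta> = (\<chi> b b'. if b = b' then \<theta> $ fst b else 0)"

definition bond_evolution ::
    "('v, 'e::finite) qgraph \<Rightarrow> complex ^ 'e \<Rightarrow> complex ^ 'e bond ^ 'e bond" where
  "bond_evolution G \<theta> = bond_phases \<theta> ** bond_scattering G"

definition edge_intensity :: "complex ^ 'e::finite bond \<Rightarrow> 'e \<Rightarrow> real" where
  "edge_intensity a e = (cmod (a $ (e, True)))\<^sup>2 + (cmod (a $ (e, False)))\<^sup>2"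

definition secular_set :: "('v, 'e::finite) qgraph \<Rightarrow> (complex ^ 'e) set" where
  "secular_set G = {\<theta>\<in>torus. det (mat 1 - bond_evolution G \<theta>) = 0}"

text \<open>\<open>bond_evolution G \<theta>\<close> is unitary for \<open>\<theta>\<close> in the torus, so the multiplicity of an eigenvalue is
  the complex dimension (\<open>vec.dim\<close>) of its eigenspace.\<close>

definition simple_resonances :: "('v, 'e::finite) qgraph \<Rightarrow> 'e set \<Rightarrow> (complex ^ 'e) set" where
  "simple_resonances G K = {\<theta>\<in>secular_set G.
     vec.dim {a. bond_evolution G \<theta> *v a = a} = 1 \<and>
     (\<exists>a. a \<noteq> 0 \<and> bond_evolution G \<theta> *v a = a \<and> (\<forall>e. edge_intensity a e > 0 \<longleftrightarrow> e \<in> K))}"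

section \<open>Arithmetic of the length vector\<close>

definition length_torus :: "real ^ 'e::finite \<Rightarrow> (complex ^ 'e) set" where
  "length_torus l = closure (range (\<lambda>k::real. torus_class (k *\<^sub>R l)))"

text \<open>The dimension of the closed subgroup \<open>length_torus l\<close> is that of its Lie algebra.\<close>

definition length_torus_dim :: "real ^ 'e::finite \<Rightarrow> nat" where
  "length_torus_dim l = dim {v. \<forall>t::real. torus_class (t *\<^sub>R v) \<in> length_torus l}"

definition RAC :: "('v, 'e::finite) qgraph \<Rightarrow> 'e set \<Rightarrow> real ^ 'e \<Rightarrow> bool" where
  "RAC G K l \<longleftrightarrow> length_torus l \<inter> simple_resonances G K \<noteq> {}"

definition of_int_vec :: "int ^ 'n \<Rightarrow> real ^ 'n" where
  "of_int_vec q = (\<chi> i. of_int (q $ i))"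

text \<open>Lie group isomorphisms onto \<open>length_torus l\<close> induced by an integer matrix \<open>M\<close>.\<close>

definition lattice_isomorphism ::
    "real ^ 'e::finite \<Rightarrow> (complex ^ 'r::finite \<Rightarrow> complex ^ 'e) \<Rightarrow> bool" where
  "lattice_isomorphism l \<Xi> \<longleftrightarrow>
     (\<exists>\<Psi>. homeomorphism torus (length_torus l) \<Xi> \<Psi>) \<and>
     (\<forall>x\<in>torus. \<forall>y\<in>torus. \<Xi> (x * y) = \<Xi> x * \<Xi> y) \<and>
     (\<exists>M :: int ^ 'r ^ 'e. \<forall>x. \<Xi> (torus_class x) = torus_class ((\<chi> e. of_int_vec (M $ e)) *v x))"

definition diophantine :: "real \<Rightarrow> real \<Rightarrow> real ^ 'r::finite \<Rightarrow> bool" where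
  "diophantine \<gamma> \<tau> \<beta> \<longleftrightarrow> (\<forall>q :: int ^ 'r. q \<noteq> 0 \<longrightarrow>
     \<bar>of_int_vec q \<bullet> (\<beta> /\<^sub>R norm \<beta>)\<bar> \<ge> \<gamma> * norm (of_int_vec q) powr (- \<tau>))"

end

theory Submission
  imports Defs
begin

text \<open>
  Near a simple resonance \<open>\<theta>\<close> of \<open>K\<close> in the torus, the phase vectors for which \<open>1\<close> is an eigenvalue of
  the bond evolution form a hypersurface transversal to the direction \<open>l\<close>. The flow \<open>t l\<close> comes
  \<open>1 / P\<close>-close to \<open>\<theta>\<close> at times of order \<open>P powr \<tau>\<close>, by a large sieve argument at the sharp
  scale, so that there is an eigenvalue \<open>k\<^sup>2\<close> with \<open>k\<close> of this order and \<open>k l\<close> within \<open>O(1 / P)\<close> of \<open>\<theta>\<close>.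
  As the eigenvector at \<open>\<theta>\<close> is simple and supported on \<open>K\<close>, the eigenfunction has energy
  \<open>O(1 / P\<^sup>2)\<close>, that is \<open>O((k\<^sup>2) powr (- 1 / \<tau>))\<close>, outside \<open>K\<close>; its evolution is a mere phase.
\<close>

section \<open>Mean values over separated frequencies\<close>

text \<open>The exponent depends on the time needed to come within 1 / P of a point. Bounding each
  Fourier term by the worst small divisor and summing would lose a power of P. A quadratic mean
  avoids this: frequencies of norm at most N have mutual gaps of order
  \<open>N powr (- \<tau>)\<close>, so over a window of the reciprocal length all exponentials are
  almost orthogonal at once. As the window may start anywhere, it is placed near
  \<open>real P powr \<tau>\<close>, which makes k comparable to this number and 1 / P^2 comparable
  to \<open>(k\<^sup>2) powr (- 1 / \<tau>)\<close>. Closeness to the resonance alone does not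
  suffice, since k has to be an exact frequency: a further time of order 1 / P along the flow must
  reach the secular set. Positivity of all entries of \<open>l\<close> secures the transversality,
  and the intermediate value theorem replaces a smooth implicit function. Normalising in L2 costs
  only a bounded factor because the two opposite waves on an edge decouple at high
  frequency.\<close>

lemma norm_one_minus_cis: "cmod (1 - cis t) = 2 * \<bar>sin (t / 2)\<bar>"
  using dist_exp_i_1[of t] by (simp add: cis_conv_exp norm_minus_commute)

lemma norm_one_minus_cis_le: "cmod (1 - cis t) \<le> \<bar>t\<bar>"
  using abs_sin_x_le_abs_x[of "t / 2"] by (simp add: norm_one_minus_cis)

text \<open>Jordan's inequality with the cruder constant 1/2, the value of cos at \<pi>/3: up to
  there the mean value theorem applies, and beyond it sin x is at least sqrt 3 / 2 \<ge> 4/5 >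
  \<pi>/4.\<close>

lemma sin_ge_half:
  fixes x :: real
  assumes "0 \<le> x" "x \<le> pi / 2"
  shows "x / 2 \<le> sin x"
proof (cases "x \<le> pi / 3")
  case True
  have "x / 2 - x / 2 \<le> sin x - x / 2"
  proof (cases "x = 0")
    case False
    then have "0 < x" using assms by simp
    then obtain z where z: "0 < z" "z < x" "sin x - sin 0 = (x - 0) * cos z"
      using MVT2[of 0 x sin cos] DERIV_sin by blast
    have "cos (pi / 3) \<le> cos z"
      using z True by (intro cos_monotone_0_pi_le) auto
    then have "x * (1 / 2) \<le> x * cos z"
      using \<open>0 < x\<close> by (intro mult_left_mono) (auto simp: cos_60)
    then show ?thesis using z by simp
  qed simp
  then show ?thesis by simp
next
  case False
  have "sin (pi / 3) \<le> sin x"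
    using False assms by (intro sin_monotone_2pi_le) auto
  moreover have "(8 / 5)\<^sup>2 \<le> (3::real)" by (simp add: power2_eq_square)
  then have "8 / 5 \<le> sqrt 3" by (rule real_le_rsqrt)
  moreover have "pi < 32 / 10" using pi_approx by simp
  ultimately show ?thesis using assms by (simp add: sin_60)
qed

lemma abs_le_norm_one_minus_cis:
  assumes "\<bar>t\<bar> \<le> pi"
  shows "\<bar>t\<bar> \<le> 2 * cmod (1 - cis t)"
proof -
  have "\<bar>t\<bar> / 2 / 2 \<le> sin (\<bar>t\<bar> / 2)"
    using assms by (intro sin_ge_half) auto
  also have "\<dots> \<le> \<bar>sin (t / 2)\<bar>"
    by (cases "t \<ge> 0") auto
  finally show ?thesis by (simp add: norm_one_minus_cis)
qed

lemma norm_sum_cis_le: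
  assumes "t \<noteq> 0" "\<bar>t\<bar> \<le> pi"
  shows "cmod (\<Sum>m<M. cis (t * real m)) \<le> 4 / \<bar>t\<bar>"
proof -
  have ge: "\<bar>t\<bar> \<le> 2 * cmod (1 - cis t)"
    by (rule abs_le_norm_one_minus_cis) fact
  have pos: "0 < cmod (1 - cis t)" using ge assms by (smt (verit))
  then have "1 - cis t \<noteq> 0" by force
  have "(\<Sum>m<M. cis (t * real m)) = (\<Sum>m<M. cis t ^ m)"
    by (simp add: Complex.DeMoivre mult.commute)
  also have "\<dots> = (1 - cis t ^ M) / (1 - cis t)"
    using \<open>1 - cis t \<noteq> 0\<close> by (simp add: sum_gp_strict)
  also have "cmod \<dots> \<le> 2 / cmod (1 - cis t)"
    using pos norm_triangle_ineq4[of 1 "cis t ^ M"]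
    by (simp add: norm_divide norm_power divide_right_mono)
  also have "\<dots> \<le> 4 / \<bar>t\<bar>"
    using ge pos assms by (simp add: field_simps)
  finally show ?thesis .
qed

section \<open>Sums of inverse squares over separated reals\<close>

lemma sum_inverse_squares_le: "(\<Sum>n=1..m. 1 / (real n)\<^sup>2) \<le> 2 - 1 / real m"
proof (induction m)
  case (Suc m)
  show ?case
  proof (cases "m = 0")
    case False
    have "1 / (real (Suc m))\<^sup>2 \<le> 1 / (real m * real (Suc m))"
      using False by (intro divide_left_mono) (auto simp: power2_eq_square)
    also have "\<dots> = 1 / real m - 1 / real (Suc m)"
      using False by (simp add: field_simps)
    finally show ?thesis using Suc.IH by simp
  qed simp
qed simp

text \<open>Rounding \<open>\<mu> p / s\<close> down is injective on separated points and lands in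
  the positive integers, and \<open>\<mu> p\<close> is at least s times its integer; so the series
  of inverse squares dominates.\<close>

lemma sum_inverse_squares_separated_pos:
  fixes \<mu> :: "'a \<Rightarrow> real"
  assumes "finite A" "s > 0" and ge: "\<And>p. p \<in> A \<Longrightarrow> s \<le> \<mu> p"
    and sep: "\<And>p q. p \<in> A \<Longrightarrow> q \<in> A \<Longrightarrow> p \<noteq> q \<Longrightarrow> s \<le> \<bar>\<mu> p - \<mu> q\<bar>"
  shows "(\<Sum>p\<in>A. 1 / (\<mu> p)\<^sup>2) \<le> 2 / s\<^sup>2"
proof -
  define n where "n p = nat \<lfloor>\<mu> p / s\<rfloor>" for p
  have n1: "1 \<le> n p" and nle: "real (n p) \<le> \<mu> p / s" and ngt: "\<mu> p / s < real (n p) + 1" if "p \<in> A" for p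
  proof -
    have "1 \<le> \<mu> p / s" using ge[OF that] \<open>s > 0\<close> by simp
    then have "1 \<le> \<lfloor>\<mu> p / s\<rfloor>" by simp
    then have "real (n p) = of_int \<lfloor>\<mu> p / s\<rfloor>" "1 \<le> n p" unfolding n_def by (simp_all add: le_nat_iff)
    then show "1 \<le> n p" "real (n p) \<le> \<mu> p / s" "\<mu> p / s < real (n p) + 1" by linarith+
  qed
  have inj: "inj_on n A"
  proof (rule inj_onI, rule ccontr)
    fix p q assume pq: "p \<in> A" "q \<in> A" "n p = n q" "p \<noteq> q"
    have "\<bar>\<mu> p / s - \<mu> q / s\<bar> < 1" using nle[of p] nle[of q] ngt[of p] ngt[of q] pq by linarith
    moreover have "\<bar>\<mu> p / s - \<mu> q / s\<bar> = \<bar>\<mu> p - \<mu> q\<bar> / s"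
      using \<open>s > 0\<close> by (simp add: diff_divide_distrib[symmetric])
    ultimately show False using sep[of p q] pq \<open>s > 0\<close> by (simp add: field_simps)
  qed
  have "(\<Sum>p\<in>A. 1 / (\<mu> p)\<^sup>2) \<le> (\<Sum>p\<in>A. 1 / s\<^sup>2 * (1 / (real (n p))\<^sup>2))"
  proof (rule sum_mono)
    fix p assume p: "p \<in> A"
    have "0 < s * real (n p)" using n1[OF p] \<open>s > 0\<close> by simp
    moreover have "s * real (n p) \<le> \<mu> p" using nle[OF p] \<open>s > 0\<close> by (simp add: field_simps)
    ultimately have "(s * real (n p))\<^sup>2 \<le> (\<mu> p)\<^sup>2" "0 < (s * real (n p))\<^sup>2"
      by (intro power_mono zero_less_power; simp)+
    then have "1 / (\<mu> p)\<^sup>2 \<le> 1 / (s * real (n p))\<^sup>2" by (intro frac_le) linarith+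
    then show "1 / (\<mu> p)\<^sup>2 \<le> 1 / s\<^sup>2 * (1 / (real (n p))\<^sup>2)" by (simp add: power_mult_distrib)
  qed
  also have "\<dots> = 1 / s\<^sup>2 * (\<Sum>m\<in>n ` A. 1 / (real m)\<^sup>2)"
    by (simp add: sum_distrib_left sum.reindex[OF inj])
  \<comment> \<open>The extra element 1 keeps \<open>Max\<close> defined when A is empty.\<close>
  also have "\<dots> \<le> 1 / s\<^sup>2 * (\<Sum>m=1..Max (n ` A \<union> {1}). 1 / (real m)\<^sup>2)"
    using \<open>finite A\<close> n1 by (intro mult_left_mono sum_mono2) auto
  also have "\<dots> \<le> 1 / s\<^sup>2 * 2"
    by (intro mult_left_mono order_trans[OF sum_inverse_squares_le]) auto
  finally show ?thesis by simp
qed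

lemma sum_inverse_squares_separated:
  fixes \<mu> :: "'a \<Rightarrow> real"
  assumes "finite A" "s > 0" and ge: "\<And>p. p \<in> A \<Longrightarrow> s \<le> \<bar>\<mu> p\<bar>"
    and sep: "\<And>p q. p \<in> A \<Longrightarrow> q \<in> A \<Longrightarrow> p \<noteq> q \<Longrightarrow> s \<le> \<bar>\<mu> p - \<mu> q\<bar>"
  shows "(\<Sum>p\<in>A. 1 / (\<mu> p)\<^sup>2) \<le> 4 / s\<^sup>2"
proof -
  let ?P = "{p\<in>A. 0 \<le> \<mu> p}" and ?N = "{p\<in>A. \<mu> p < 0}"
  have "(\<Sum>p\<in>A. 1 / (\<mu> p)\<^sup>2) = (\<Sum>p\<in>?P \<union> ?N. 1 / (\<mu> p)\<^sup>2)"
    by (intro sum.cong) auto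
  also have "\<dots> = (\<Sum>p\<in>?P. 1 / (\<mu> p)\<^sup>2) + (\<Sum>p\<in>?N. 1 / (- \<mu> p)\<^sup>2)"
    using \<open>finite A\<close> by (subst sum.union_disjoint) auto
  also have "(\<Sum>p\<in>?P. 1 / (\<mu> p)\<^sup>2) \<le> 2 / s\<^sup>2"
    using \<open>finite A\<close> \<open>s > 0\<close> by (intro sum_inverse_squares_separated_pos) (use ge sep in \<open>force+\<close>)
  also have "(\<Sum>p\<in>?N. 1 / (- \<mu> p)\<^sup>2) \<le> 2 / s\<^sup>2"
  proof (intro sum_inverse_squares_separated_pos)
    fix p q assume "p \<in> ?N" "q \<in> ?N" "p \<noteq> q"
    then show "s \<le> \<bar>- \<mu> p - - \<mu> q\<bar>" using sep[of p q] by (simp add: abs_minus_commute)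
  qed (use assms(1,2) ge in \<open>force+\<close>)
  finally show ?thesis by simp
qed

text \<open>Averaging over sums of two times squares the Dirichlet kernel, whose decay then is summable
  over separated frequencies.\<close>

definition time_average :: "real \<Rightarrow> real \<Rightarrow> nat \<Rightarrow> (real \<Rightarrow> 'a::real_vector) \<Rightarrow> 'a" where
  "time_average t0 h M f =
     (\<Sum>(m, n)\<in>{..<M} \<times> {..<M}. f (t0 + h * (real m + real n))) /\<^sub>R (real M)\<^sup>2"

lemma time_average_add: "time_average t0 h M (\<lambda>t. f t + g t) = time_average t0 h M f + time_average t0 h M g"
  by (simp add: time_average_def sum.distrib split_def scaleR_add_right)

lemma time_average_sum: "time_average t0 h M (\<lambda>t. \<Sum>i\<in>I. f i t) = (\<Sum>i\<in>I. time_average t0 h M (f i))"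
  unfolding time_average_def split_def by (subst sum.swap) (simp add: scaleR_sum_right)

lemma time_average_mult:
  fixes f :: "real \<Rightarrow> 'a::real_algebra"
  shows "time_average t0 h M (\<lambda>t. c * f t) = c * time_average t0 h M f"
  unfolding time_average_def split_def by (simp add: sum_distrib_left)

lemma time_average_of_real:
  "time_average t0 h M (\<lambda>t. complex_of_real (f t)) = complex_of_real (time_average t0 h M f)"
  unfolding time_average_def split_def by (simp add: scaleR_conv_of_real)

lemma time_average_const: "M > 0 \<Longrightarrow> time_average t0 h M (\<lambda>t. c) = c"
  unfolding time_average_def split_def by (simp add: power2_eq_square sum_constant_scaleR field_simps)

text \<open>The window has length 2 M h because a sampled time involves the sum of two indices, each
  below M.\<close>

lemma time_average_pos_imp:
  fixes f :: "real \<Rightarrow> real"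
  assumes "time_average t0 h M f > 0" "h > 0"
  obtains t where "t0 \<le> t" "t \<le> t0 + 2 * (real M * h)" "f t > 0"
proof -
  have "\<exists>(m, n)\<in>{..<M} \<times> {..<M}. f (t0 + h * (real m + real n)) > 0"
  proof (rule ccontr)
    assume "\<not> ?thesis"
    then have "time_average t0 h M f \<le> 0"
      unfolding time_average_def by (auto intro!: mult_nonneg_nonpos sum_nonpos simp: not_less)
    then show False using assms by simp
  qed
  then obtain m n where mn: "m < M" "n < M" "f (t0 + h * (real m + real n)) > 0" by auto
  moreover have "h * (real m + real n) \<le> h * (2 * real M)"
    using mn \<open>h > 0\<close> by (intro mult_left_mono) auto
  ultimately show ?thesis
    using \<open>h > 0\<close> by (intro that[of "t0 + h * (real m + real n)"]) (auto simp: mult_ac)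
qed

text \<open>The double sum is the square of one geometric sum times a unimodular phase carrying t0;
  hence the decay like 1 / u^2, whatever the starting time. The bound on \<open>u * h\<close> rules
  out aliasing, where successive samples would nearly repeat.\<close>

lemma norm_time_average_cis_le:
  assumes "u \<noteq> 0" "\<bar>u * h\<bar> \<le> pi" "M > 0" "h > 0"
  shows "cmod (time_average t0 h M (\<lambda>t. cis (u * t))) \<le> 16 / (real M * h)\<^sup>2 * (1 / u\<^sup>2)"
proof -
  have "(\<Sum>(m, n)\<in>{..<M} \<times> {..<M}. cis (u * (t0 + h * (real m + real n))))
      = (\<Sum>m<M. \<Sum>n<M. cis (u * t0) * (cis (u * h * real m) * cis (u * h * real n)))"
    by (simp add: sum.cartesian_product cis_mult algebra_simps)
  also have "\<dots> = cis (u * t0) * (\<Sum>m<M. cis (u * h * real m))\<^sup>2"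
    by (subst power2_eq_square, subst sum_product) (simp add: sum_distrib_left)
  finally have "cmod (time_average t0 h M (\<lambda>t. cis (u * t)))
      = (cmod (\<Sum>m<M. cis (u * h * real m)))\<^sup>2 / (real M)\<^sup>2"
    by (simp add: time_average_def norm_mult norm_power divide_inverse mult.commute)
  also have "\<dots> \<le> (4 / \<bar>u * h\<bar>)\<^sup>2 / (real M)\<^sup>2"
    using assms by (intro divide_right_mono power_mono norm_sum_cis_le) auto
  also have "\<dots> = 16 / (real M * h)\<^sup>2 * (1 / u\<^sup>2)"
    by (simp add: power_divide power_mult_distrib abs_mult field_simps)
  finally show ?thesis .
qed

text \<open>Expanding the square leaves the diagonal, which is the sum of squares, plus terms
  oscillating with the nonzero differences of frequencies. The matrix of their averages has row sums
  at most 1/4, and this bounds its quadratic form.\<close>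

lemma time_average_large_sieve:
  fixes \<mu> :: "'a \<Rightarrow> real" and b :: "'a \<Rightarrow> complex"
  assumes "finite A" "s > 0" "M > 0" "h > 0"
    and sep: "\<And>p q. p \<in> A \<Longrightarrow> q \<in> A \<Longrightarrow> p \<noteq> q \<Longrightarrow> s \<le> \<bar>\<mu> p - \<mu> q\<bar>"
    and small: "\<And>p q. p \<in> A \<Longrightarrow> q \<in> A \<Longrightarrow> \<bar>\<mu> p - \<mu> q\<bar> * h \<le> pi"
    and long: "16 \<le> real M * h * s"
  shows "\<bar>time_average t0 h M (\<lambda>t. (cmod (\<Sum>p\<in>A. b p * cis (\<mu> p * t)))\<^sup>2) - (\<Sum>p\<in>A. (cmod (b p))\<^sup>2)\<bar>
    \<le> 1 / 4 * (\<Sum>p\<in>A. (cmod (b p))\<^sup>2)"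
proof -
  define E where "E u = time_average t0 h M (\<lambda>t. cis (u * t))" for u
  define e where "e p q = (if p = q then 0 else 16 / (real M * h)\<^sup>2 * (1 / (\<mu> p - \<mu> q)\<^sup>2))" for p q
  have e_sym: "e p q = e q p" for p q by (simp add: e_def power2_commute)
  have e_nonneg: "0 \<le> e p q" for p q by (simp add: e_def)
  have E0: "E 0 = 1" using \<open>M > 0\<close> by (simp add: E_def time_average_const)
  have E_le: "cmod (E (\<mu> p - \<mu> q) - (if p = q then 1 else 0)) \<le> e p q" if "p \<in> A" "q \<in> A" for p q
  proof (cases "p = q")
    case False
    then have "\<mu> p - \<mu> q \<noteq> 0" using sep[OF that False] \<open>s > 0\<close> by auto
    then show ?thesis
      using norm_time_average_cis_le[of "\<mu> p - \<mu> q" h M t0] small[OF that] False assms(3,4)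
      by (simp add: e_def E_def abs_mult)
  qed (simp add: E0 e_def)
  have row: "(\<Sum>q\<in>A. e p q) \<le> 1 / 4" if p: "p \<in> A" for p
  proof -
    have "(\<Sum>q\<in>A. e p q) = (\<Sum>q\<in>A - {p}. e p q)"
      using \<open>finite A\<close> by (intro sum.mono_neutral_right) (auto simp: e_def)
    also have "\<dots> = 16 / (real M * h)\<^sup>2 * (\<Sum>q\<in>A - {p}. 1 / (\<mu> p - \<mu> q)\<^sup>2)"
      unfolding sum_distrib_left by (intro sum.cong) (auto simp: e_def)
    also have "\<dots> \<le> 16 / (real M * h)\<^sup>2 * (4 / s\<^sup>2)"
    proof (intro mult_left_mono sum_inverse_squares_separated)
      fix q q' assume "q \<in> A - {p}" "q' \<in> A - {p}" "q \<noteq> q'"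
      then show "s \<le> \<bar>\<mu> p - \<mu> q - (\<mu> p - \<mu> q')\<bar>" using sep[of q' q] by simp
    next
      fix q assume "q \<in> A - {p}"
      then show "s \<le> \<bar>\<mu> p - \<mu> q\<bar>" using sep[of p q] p by auto
    qed (use assms in auto)
    also have "\<dots> = 64 / (real M * h * s)\<^sup>2"
      by (simp add: power_mult_distrib)
    \<comment> \<open>The number 16 in the hypothesis \<open>long\<close> is made for this place: 16
      from the kernel and 4 from the inverse squares give 64 / 16^2 = 1/4.\<close>
    also have "\<dots> \<le> 64 / 16\<^sup>2"
      using long assms(2-4) by (intro divide_left_mono power_mono) auto
    finally show ?thesis by simp
  qed
  have "complex_of_real ((cmod (\<Sum>p\<in>A. b p * cis (\<mu> p * t)))\<^sup>2)
      = (\<Sum>p\<in>A. \<Sum>q\<in>A. b p * cnj (b q) * cis ((\<mu> p - \<mu> q) * t))" for t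
  proof -
    have "cis (\<mu> p * t) * cnj (cis (\<mu> q * t)) = cis ((\<mu> p - \<mu> q) * t)" for p q
      by (simp add: cis_cnj cis_mult left_diff_distrib)
    then have "b p * cis (\<mu> p * t) * cnj (b q * cis (\<mu> q * t)) = b p * cnj (b q) * cis ((\<mu> p - \<mu> q) * t)" for p q
      by (simp add: mult_ac)
    then show ?thesis
      unfolding complex_norm_square cnj_sum sum_product by (simp only:)
  qed
  then have "complex_of_real (time_average t0 h M (\<lambda>t. (cmod (\<Sum>p\<in>A. b p * cis (\<mu> p * t)))\<^sup>2))
      = time_average t0 h M (\<lambda>t. \<Sum>p\<in>A. \<Sum>q\<in>A. b p * cnj (b q) * cis ((\<mu> p - \<mu> q) * t))"
    by (simp add: time_average_of_real[symmetric])
  also have "\<dots> = (\<Sum>p\<in>A. \<Sum>q\<in>A. b p * cnj (b q) * E (\<mu> p - \<mu> q))"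
    by (simp add: time_average_sum time_average_mult E_def)
  finally have "complex_of_real (time_average t0 h M (\<lambda>t. (cmod (\<Sum>p\<in>A. b p * cis (\<mu> p * t)))\<^sup>2) - (\<Sum>p\<in>A. (cmod (b p))\<^sup>2))
      = (\<Sum>p\<in>A. \<Sum>q\<in>A. b p * cnj (b q) * (E (\<mu> p - \<mu> q) - (if p = q then 1 else 0)))"
  proof -
    assume *: "complex_of_real (time_average t0 h M (\<lambda>t. (cmod (\<Sum>p\<in>A. b p * cis (\<mu> p * t)))\<^sup>2))
      = (\<Sum>p\<in>A. \<Sum>q\<in>A. b p * cnj (b q) * E (\<mu> p - \<mu> q))"
    have "(\<Sum>p\<in>A. \<Sum>q\<in>A. b p * cnj (b q) * (if p = q then 1 else 0)) = complex_of_real (\<Sum>p\<in>A. (cmod (b p))\<^sup>2)"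
      using \<open>finite A\<close> by (simp add: complex_norm_square[symmetric] if_distrib[of "\<lambda>x. _ * x"] cong: if_cong)
    then show ?thesis using * by (simp add: right_diff_distrib sum_subtractf)
  qed
  then have "\<bar>time_average t0 h M (\<lambda>t. (cmod (\<Sum>p\<in>A. b p * cis (\<mu> p * t)))\<^sup>2) - (\<Sum>p\<in>A. (cmod (b p))\<^sup>2)\<bar>
      = cmod (\<Sum>p\<in>A. \<Sum>q\<in>A. b p * cnj (b q) * (E (\<mu> p - \<mu> q) - (if p = q then 1 else 0)))"
    by (simp only: norm_of_real flip: norm_of_real[where ?'a = complex])
  \<comment> \<open>Schur test: 2 x y \<le> x^2 + y^2 and the symmetry of \<open>e\<close> reduce
    the double sum to row sums.\<close>
  also have "\<dots> \<le> (\<Sum>p\<in>A. \<Sum>q\<in>A. 1 / 2 * ((cmod (b p))\<^sup>2 * e p q) + 1 / 2 * ((cmod (b q))\<^sup>2 * e p q))"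
  proof (intro sum_norm_le)
    fix p q assume pq: "p \<in> A" "q \<in> A"
    have "cmod (b p * cnj (b q) * (E (\<mu> p - \<mu> q) - (if p = q then 1 else 0))) \<le> cmod (b p) * cmod (b q) * e p q"
      unfolding norm_mult complex_mod_cnj by (intro mult_left_mono E_le pq) auto
    also have "\<dots> \<le> (((cmod (b p))\<^sup>2 + (cmod (b q))\<^sup>2) / 2) * e p q"
      using sum_squares_bound[of "cmod (b p)" "cmod (b q)"] by (intro mult_right_mono e_nonneg) auto
    finally show "cmod (b p * cnj (b q) * (E (\<mu> p - \<mu> q) - (if p = q then 1 else 0)))
        \<le> 1 / 2 * ((cmod (b p))\<^sup>2 * e p q) + 1 / 2 * ((cmod (b q))\<^sup>2 * e p q)"
      by (simp add: algebra_simps add_divide_distrib)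
  qed
  also have "\<dots> = 1 / 2 * (\<Sum>p\<in>A. \<Sum>q\<in>A. (cmod (b p))\<^sup>2 * e p q) + 1 / 2 * (\<Sum>p\<in>A. \<Sum>q\<in>A. (cmod (b q))\<^sup>2 * e p q)"
    by (simp add: sum.distrib sum_distrib_left)
  also have "(\<Sum>p\<in>A. \<Sum>q\<in>A. (cmod (b q))\<^sup>2 * e p q) = (\<Sum>p\<in>A. \<Sum>q\<in>A. (cmod (b p))\<^sup>2 * e p q)"
    by (subst sum.swap) (simp add: e_sym)
  also have "1 / 2 * (\<Sum>p\<in>A. \<Sum>q\<in>A. (cmod (b p))\<^sup>2 * e p q) + 1 / 2 * (\<Sum>p\<in>A. \<Sum>q\<in>A. (cmod (b p))\<^sup>2 * e p q)
      = (\<Sum>p\<in>A. (cmod (b p))\<^sup>2 * (\<Sum>q\<in>A. e p q))"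
    by (simp add: sum_distrib_left)
  also have "\<dots> \<le> (\<Sum>p\<in>A. (cmod (b p))\<^sup>2 * (1 / 4))"
    by (intro sum_mono mult_left_mono row) auto
  finally show ?thesis by (simp add: sum_distrib_left mult.commute)
qed

section \<open>Density of Diophantine flows\<close>

lemma of_int_vec_diff: "of_int_vec (p - q) = of_int_vec p - of_int_vec q"
  by (simp add: of_int_vec_def vec_eq_iff)

lemma of_int_vec_add: "of_int_vec (p + q) = of_int_vec p + of_int_vec q"
  by (simp add: of_int_vec_def vec_eq_iff)

lemma of_int_vec_axis: "of_int_vec (axis j 1) = axis j 1"
  by (simp add: of_int_vec_def vec_eq_iff axis_def)

lemma card_int_box:
  "finite {q :: int ^ 'n::finite. \<forall>j. \<bar>q $ j\<bar> \<le> int m}"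
  "card {q :: int ^ 'n::finite. \<forall>j. \<bar>q $ j\<bar> \<le> int m} = (2 * m + 1) ^ CARD('n)"
proof -
  let ?I = "{- int m..int m}"
  have eq: "{q :: int ^ 'n. \<forall>j. \<bar>q $ j\<bar> \<le> int m} = vec_lambda ` (PiE UNIV (\<lambda>_. ?I))"
  proof (intro equalityI subsetI)
    fix q :: "int ^ 'n" assume "q \<in> {q. \<forall>j. \<bar>q $ j\<bar> \<le> int m}"
    then have "($) q \<in> PiE UNIV (\<lambda>_. ?I)" by (auto simp: PiE_UNIV_domain abs_le_iff minus_le_iff)
    moreover have "q = vec_lambda (($) q)" by simp
    ultimately show "q \<in> vec_lambda ` (PiE UNIV (\<lambda>_. ?I))" by blast
  qed (auto simp: PiE_UNIV_domain abs_le_iff minus_le_iff Pi_iff)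
  show "finite {q :: int ^ 'n. \<forall>j. \<bar>q $ j\<bar> \<le> int m}"
    unfolding eq by (intro finite_imageI finite_PiE) auto
  have "inj_on vec_lambda (PiE (UNIV :: 'n set) (\<lambda>_. ?I))"
    by (rule inj_onI) (metis vec_lambda_beta ext)
  then show "card {q :: int ^ 'n. \<forall>j. \<bar>q $ j\<bar> \<le> int m} = (2 * m + 1) ^ CARD('n)"
    unfolding eq by (subst card_image) (auto simp: card_PiE nat_add_distrib nat_mult_distrib)
qed

text \<open>The Fejer-type weight \<open>max 0 (N - norm q)\<close> concentrates \<open>f\<close> at \<open>x\<close> to scale \<open>1 / N\<close>, since
  multiplying \<open>f\<close> by \<open>1 - cis (y\<^sub>j)\<close> amounts to differencing its coefficients, which become
  smaller by a factor \<open>N\<close>. The spectrum \<open>q \<bullet> \<beta>\<close> is separated by the Diophantine condition, so that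
  a time of order \<open>N powr \<tau>\<close> suffices to see this in the mean.\<close>

lemma diophantine_flow_dense:
  fixes \<beta> :: "real ^ 'r::finite"
  assumes "\<gamma> > 0" "\<tau> > 0" and dioph: "diophantine \<gamma> \<tau> \<beta>"
  shows "\<exists>C>0. \<forall>x t0 P. P \<ge> (1::nat) \<longrightarrow> (\<exists>t\<ge>t0. t \<le> t0 + C * real P powr \<tau> \<and>
    (\<Sum>j\<in>UNIV. (cmod (1 - cis (t * \<beta> $ j - x $ j)))\<^sup>2) \<le> C / (real P)\<^sup>2)"
proof -
  let ?v = "of_int_vec :: int ^ 'r \<Rightarrow> real ^ 'r"
  define r where "r = CARD('r)"
  have r1: "1 \<le> r" by (simp add: r_def Suc_leI)
  \<comment> \<open>For \<beta> = 0 all products vanish, against the positive lower bound demanded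
    at a unit lattice vector.\<close>
  have "\<beta> \<noteq> 0"
  proof
    assume "\<beta> = 0"
    have "(axis undefined 1 :: int ^ 'r) \<noteq> 0" by (simp add: axis_eq_0_iff)
    with dioph have "\<gamma> * norm (?v (axis undefined 1)) powr (- \<tau>) \<le> 0"
      unfolding diophantine_def using \<open>\<beta> = 0\<close> by fastforce
    then show False using \<open>\<gamma> > 0\<close> by (simp add: of_int_vec_axis mult_le_0_iff)
  qed
  then have \<beta>_pos: "norm \<beta> > 0" by simp
  have v_inner_ge: "\<gamma> * norm \<beta> * R powr (- \<tau>) \<le> \<bar>?v q \<bullet> \<beta>\<bar>" if "q \<noteq> 0" "norm (?v q) \<le> R" for q R
  proof -
    have "?v q \<noteq> 0" using \<open>q \<noteq> 0\<close> by (simp add: of_int_vec_def vec_eq_iff)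
    then have "R powr (- \<tau>) \<le> norm (?v q) powr (- \<tau>)"
      using that \<open>\<tau> > 0\<close> by (intro powr_mono2') auto
    then have "\<gamma> * R powr (- \<tau>) \<le> \<bar>?v q \<bullet> (\<beta> /\<^sub>R norm \<beta>)\<bar>"
      using dioph \<open>q \<noteq> 0\<close> \<open>\<gamma> > 0\<close> unfolding diophantine_def
      by (meson mult_left_mono less_imp_le order_trans)
    also have "\<dots> = \<bar>?v q \<bullet> \<beta>\<bar> / norm \<beta>" by (simp add: abs_mult divide_inverse mult.commute)
    finally show ?thesis using \<beta>_pos by (simp add: field_simps)
  qed
  \<comment> \<open>\<open>D\<close> compares the number of lattice points in a cube of half-width N
    + 1 with that for half-width P. In \<open>C\<close> the first two terms come from the window
    length, the last one from the squared distance.\<close>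
  define D where "D = real ((3 * r) ^ r)"
  define C where "C = 32 * (6 * real r) powr \<tau> / (\<gamma> * norm \<beta>) + 2 + 2 * D"
  have D_pos: "D > 0" using r1 by (simp add: D_def)
  have "C > 0" using \<open>\<gamma> > 0\<close> \<beta>_pos D_pos by (simp add: C_def add_nonneg_pos)
  moreover have "\<exists>t\<ge>t0. t \<le> t0 + C * real P powr \<tau> \<and>
       (\<Sum>j\<in>UNIV. (cmod (1 - cis (t * \<beta> $ j - x $ j)))\<^sup>2) \<le> C / (real P)\<^sup>2"
    if P: "P \<ge> 1" for x t0 P
  proof -
    \<comment> \<open>Twice the bound r P for the norm on the cube of half-width P, so that the
      weight \<open>a\<close> is at least r P on this cube.\<close>
    define N where "N = 2 * r * P"
    \<comment> \<open>The radius exceeds that of the support of \<open>a\<close> by 1, so that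
      \<open>Q\<close> also contains the support shifted by a unit vector.\<close>
    define Q where "Q = {q. norm (?v q) \<le> real (N + 1)}"
    define a where "a q = max 0 (real N - norm (?v q))" for q
    define \<Delta> where "\<Delta> j q = a q - a (q - axis j 1)" for j q
    define \<phi> where "\<phi> t q = ?v q \<bullet> (t *\<^sub>R \<beta> - x)" for t q
    define f where "f t = (\<Sum>q\<in>Q. complex_of_real (a q) * cis (\<phi> t q))" for t
    define g where "g j t = (\<Sum>q\<in>Q. complex_of_real (\<Delta> j q) * cis (\<phi> t q))" for j t
    \<comment> \<open>The spectral gap, as differences of points of \<open>Q\<close> have norm at
      most 2 (N + 1). The step \<open>h\<close> is small against the largest difference, to exclude
      aliasing, and \<open>M\<close> is the least number of steps that the sieve admits.\<close>
    define s where "s = \<gamma> * norm \<beta> * (2 * real (N + 1)) powr (- \<tau>)"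
    define h where "h = min 1 (1 / (2 * real (N + 1) * norm \<beta>))"
    define M where "M = nat \<lceil>16 / (h * s)\<rceil>"
    have s_pos: "s > 0" using \<open>\<gamma> > 0\<close> \<beta>_pos by (simp add: s_def)
    have h_pos: "h > 0" and h_le: "h \<le> 1" "h \<le> 1 / (2 * real (N + 1) * norm \<beta>)"
      using \<beta>_pos by (auto simp: h_def)
    have "0 < 16 / (h * s)" using h_pos s_pos by simp
    then have M_pos: "M > 0" and M_ge: "16 / (h * s) \<le> real M" and M_le: "real M \<le> 16 / (h * s) + 1"
      unfolding M_def by linarith+
    have long: "16 \<le> real M * h * s" using M_ge h_pos s_pos by (simp add: field_simps)
    have Q_box: "Q \<subseteq> {q. \<forall>j. \<bar>q $ j\<bar> \<le> int (N + 1)}"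
    proof (intro subsetI CollectI allI)
      fix q j assume "q \<in> Q"
      then have "\<bar>?v q $ j\<bar> \<le> real (N + 1)"
        using component_le_norm_cart[of "?v q" j] unfolding Q_def by (simp del: of_nat_add)
      then show "\<bar>q $ j\<bar> \<le> int (N + 1)" by (simp add: of_int_vec_def)
    qed
    have finQ: "finite Q" by (rule finite_subset[OF Q_box card_int_box(1)])
    have Q_diff: "norm (?v (p - q)) \<le> 2 * real (N + 1)" if "p \<in> Q" "q \<in> Q" for p q
      using that norm_triangle_ineq4[of "?v p" "?v q"] by (simp add: Q_def of_int_vec_diff)
    have sep: "s \<le> \<bar>?v p \<bullet> \<beta> - ?v q \<bullet> \<beta>\<bar>" if "p \<in> Q" "q \<in> Q" "p \<noteq> q" for p q
      using v_inner_ge[OF _ Q_diff[OF that(1,2)]] that(3)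
      by (simp add: s_def of_int_vec_diff inner_diff_left)
    have small: "\<bar>?v p \<bullet> \<beta> - ?v q \<bullet> \<beta>\<bar> * h \<le> pi" if "p \<in> Q" "q \<in> Q" for p q
    proof -
      have "\<bar>?v p \<bullet> \<beta> - ?v q \<bullet> \<beta>\<bar> \<le> norm (?v (p - q)) * norm \<beta>"
        using Cauchy_Schwarz_ineq2[of "?v (p - q)" \<beta>] by (simp add: of_int_vec_diff inner_diff_left)
      also have "\<dots> \<le> 2 * real (N + 1) * norm \<beta>"
        using Q_diff[OF that] by (intro mult_right_mono) auto
      finally have "\<bar>?v p \<bullet> \<beta> - ?v q \<bullet> \<beta>\<bar> * h \<le> (2 * real (N + 1) * norm \<beta>) * (1 / (2 * real (N + 1) * norm \<beta>))"
        using h_le(2) h_pos by (intro mult_mono) auto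
      also have "\<dots> \<le> pi" using \<beta>_pos pi_ge_two by simp
      finally show ?thesis .
    qed
    \<comment> \<open>The offset x only multiplies each coefficient by a constant phase, which
      leaves the sum of squares unchanged.\<close>
    have sieve: "\<bar>time_average t0 h M (\<lambda>t. (cmod (\<Sum>q\<in>Q. complex_of_real (w q) * cis (\<phi> t q)))\<^sup>2) - (\<Sum>q\<in>Q. (w q)\<^sup>2)\<bar>
        \<le> 1 / 4 * (\<Sum>q\<in>Q. (w q)\<^sup>2)" for w
    proof -
      have "complex_of_real (w q) * cis (- (?v q \<bullet> x)) * cis ((?v q \<bullet> \<beta>) * t) = complex_of_real (w q) * cis (\<phi> t q)" for q t
        by (simp add: \<phi>_def inner_diff_right cis_mult mult_ac)
      moreover have "(cmod (complex_of_real (w q) * cis (- (?v q \<bullet> x))))\<^sup>2 = (w q)\<^sup>2" for q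
        by (simp add: norm_mult)
      moreover have "\<bar>time_average t0 h M (\<lambda>t. (cmod (\<Sum>q\<in>Q. complex_of_real (w q) * cis (- (?v q \<bullet> x)) * cis ((?v q \<bullet> \<beta>) * t)))\<^sup>2)
            - (\<Sum>q\<in>Q. (cmod (complex_of_real (w q) * cis (- (?v q \<bullet> x))))\<^sup>2)\<bar>
          \<le> 1 / 4 * (\<Sum>q\<in>Q. (cmod (complex_of_real (w q) * cis (- (?v q \<bullet> x))))\<^sup>2)"
        by (intro time_average_large_sieve[OF finQ s_pos M_pos h_pos _ _ long] sep small)
      ultimately show ?thesis by (simp only:)
    qed
    have g_eq: "g j t = (1 - cis (t * \<beta> $ j - x $ j)) * f t" for j t
    proof -
      have axis_norm: "norm (?v (q + axis j 1)) \<le> norm (?v q) + 1" for q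
        using norm_triangle_ineq[of "?v q" "axis j 1"] by (simp add: of_int_vec_add of_int_vec_axis)
      have "cis (t * \<beta> $ j - x $ j) * cis (\<phi> t q) = cis (\<phi> t (q + axis j 1))" for q
        unfolding \<phi>_def of_int_vec_add of_int_vec_axis inner_add_left cis_mult
        by (simp add: inner_axis' add.commute)
      then have "cis (t * \<beta> $ j - x $ j) * f t = (\<Sum>q\<in>Q. complex_of_real (a q) * cis (\<phi> t (q + axis j 1)))"
        by (simp add: f_def sum_distrib_left mult.left_commute)
      also have "\<dots> = (\<Sum>q\<in>Q. complex_of_real (a (q - axis j 1)) * cis (\<phi> t q))"
      \<comment> \<open>\<open>Q\<close> is not invariant under the shift, but the points pushed
        across its boundary carry weight 0.\<close>
      proof (rule sum.reindex_bij_witness_not_neutral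
          [where S' = "{q\<in>Q. a q = 0}" and T' = "{q\<in>Q. a (q - axis j 1) = 0}"
            and i = "\<lambda>q. q - axis j 1" and j = "\<lambda>q. q + axis j 1"])
        fix q assume "q \<in> Q - {q \<in> Q. a q = 0}"
        then show "q + axis j 1 \<in> Q - {q \<in> Q. a (q - axis j 1) = 0}"
          using axis_norm[of q] by (auto simp: a_def Q_def max_def split: if_splits)
      next
        fix q assume "q \<in> Q - {q \<in> Q. a (q - axis j 1) = 0}"
        then show "q - axis j 1 \<in> Q - {q \<in> Q. a q = 0}"
          by (auto simp: a_def Q_def max_def split: if_splits)
      qed (use finQ in auto)
      finally show ?thesis
        by (simp add: g_def f_def \<Delta>_def left_diff_distrib sum_subtractf)
    qed
    \<comment> \<open>Chosen so that the averages of the differenced sums total at most 5/8 of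
      \<epsilon> W, while \<epsilon> times the average for \<open>f\<close> is at least 3/4 of
      \<epsilon> W.\<close>
    define \<epsilon> where "\<epsilon> = 2 * D / (real r * (real P)\<^sup>2)"
    have \<epsilon>_pos: "\<epsilon> > 0" using D_pos r1 P by (simp add: \<epsilon>_def)
    define W where "W = (real r * real P)\<^sup>2 * real ((2 * P + 1) ^ r)"
    have W_pos: "W > 0" using r1 P by (simp add: W_def)
    have a_sum: "W \<le> (\<Sum>q\<in>Q. (a q)\<^sup>2)"
    proof -
      let ?B = "{q :: int ^ 'r. \<forall>j. \<bar>q $ j\<bar> \<le> int P}"
      have B: "norm (?v q) \<le> real r * real P" if "q \<in> ?B" for q
      proof -
        have "norm (?v q) \<le> (\<Sum>j\<in>UNIV. \<bar>?v q $ j\<bar>)" by (rule norm_le_l1_cart)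
        also have "\<dots> \<le> (\<Sum>j\<in>(UNIV::'r set). real P)"
        proof (rule sum_mono)
          fix j have "real_of_int \<bar>q $ j\<bar> \<le> real_of_int (int P)" using that by (subst of_int_le_iff) simp
          then show "\<bar>?v q $ j\<bar> \<le> real P" by (simp add: of_int_vec_def)
        qed
        finally show ?thesis by (simp add: r_def)
      qed
      have "W = (\<Sum>q\<in>?B. (real r * real P)\<^sup>2)"
        by (simp add: W_def card_int_box r_def)
      also have "\<dots> \<le> (\<Sum>q\<in>?B. (a q)\<^sup>2)"
        by (intro sum_mono power_mono) (use B in \<open>force simp: a_def N_def\<close>)+
      also have "\<dots> \<le> (\<Sum>q\<in>Q. (a q)\<^sup>2)"
      proof (intro sum_mono2 finQ subsetI)
        fix q assume "q \<in> ?B"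
        have "0 \<le> real r * real P" "real (N + 1) = 2 * (real r * real P) + 1" by (simp_all add: N_def)
        then show "q \<in> Q" using B[OF \<open>q \<in> ?B\<close>] unfolding Q_def mem_Collect_eq by linarith
      qed auto
      finally show ?thesis .
    qed
    have \<Delta>_sum: "(\<Sum>q\<in>Q. (\<Delta> j q)\<^sup>2) \<le> D * real ((2 * P + 1) ^ r)" for j
    proof -
      have "(\<Sum>q\<in>Q. (\<Delta> j q)\<^sup>2) \<le> (\<Sum>q\<in>Q. 1)"
      proof (rule sum_mono)
        fix q
        have "\<bar>norm (?v q) - norm (?v (q - axis j 1))\<bar> \<le> 1"
          using norm_triangle_ineq3[of "?v q" "?v (q - axis j 1)"]
          by (simp add: of_int_vec_diff of_int_vec_axis)
        then have "\<bar>\<Delta> j q\<bar> \<le> 1" unfolding \<Delta>_def a_def by linarith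
        then show "(\<Delta> j q)\<^sup>2 \<le> 1" by (simp add: abs_square_le_1)
      qed
      also have "\<dots> = real (card Q)" by simp
      also have "card Q \<le> card {q :: int ^ 'r. \<forall>j. \<bar>q $ j\<bar> \<le> int (N + 1)}"
        by (intro card_mono Q_box card_int_box)
      also have "\<dots> = (2 * (N + 1) + 1) ^ r" unfolding r_def by (rule card_int_box)
      also have "\<dots> \<le> (3 * r * (2 * P + 1)) ^ r"
        using r1 by (intro power_mono) (auto simp: N_def algebra_simps)
      also have "real \<dots> = D * real ((2 * P + 1) ^ r)" unfolding D_def by (simp only: power_mult_distrib of_nat_mult)
      finally show ?thesis by simp
    qed
    define A where "A = (\<Sum>q\<in>Q. (a q)\<^sup>2)"
    \<comment> \<open>A positive mean yields a time at which \<epsilon> |f|^2 beats the sum of the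
      |g_j|^2. As g_j is f times the deviation 1 - cis of the jth phase, the factor |f|^2 cancels
      and the squared deviations sum to at most \<epsilon>.\<close>
    have "time_average t0 h M (\<lambda>t. \<epsilon> * (cmod (f t))\<^sup>2 + (- 1) * (\<Sum>j\<in>UNIV. (cmod (g j t))\<^sup>2))
        = \<epsilon> * time_average t0 h M (\<lambda>t. (cmod (f t))\<^sup>2) - (\<Sum>j\<in>UNIV. time_average t0 h M (\<lambda>t. (cmod (g j t))\<^sup>2))"
      by (simp only: time_average_add time_average_mult time_average_sum)
    also have "\<dots> \<ge> \<epsilon> * (3 / 4 * A) - (\<Sum>j\<in>(UNIV::'r set). 5 / 4 * (D * real ((2 * P + 1) ^ r)))"
    proof (intro diff_mono mult_left_mono sum_mono)
      show "3 / 4 * A \<le> time_average t0 h M (\<lambda>t. (cmod (f t))\<^sup>2)"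
        using sieve[of a] unfolding f_def A_def by linarith
      show "time_average t0 h M (\<lambda>t. (cmod (g j t))\<^sup>2) \<le> 5 / 4 * (D * real ((2 * P + 1) ^ r))" for j
        using sieve[of "\<Delta> j"] \<Delta>_sum[of j] unfolding g_def by linarith
    qed (use \<epsilon>_pos in auto)
    moreover have "\<epsilon> * (3 / 4 * A) - (\<Sum>j\<in>(UNIV::'r set). 5 / 4 * (D * real ((2 * P + 1) ^ r))) > 0"
    proof -
      have "(\<Sum>j\<in>(UNIV::'r set). 5 / 4 * (D * real ((2 * P + 1) ^ r))) = 5 / 8 * (\<epsilon> * W)"
        using r1 P by (simp add: W_def \<epsilon>_def r_def[symmetric] power2_eq_square)
      moreover have "\<epsilon> * W \<le> \<epsilon> * A" using a_sum \<epsilon>_pos by (simp add: A_def)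
      moreover have "0 < \<epsilon> * W" using \<epsilon>_pos W_pos by simp
      ultimately show ?thesis by linarith
    qed
    ultimately have "time_average t0 h M (\<lambda>t. \<epsilon> * (cmod (f t))\<^sup>2 + (- 1) * (\<Sum>j\<in>UNIV. (cmod (g j t))\<^sup>2)) > 0"
      by linarith
    then obtain t where t: "t0 \<le> t" "t \<le> t0 + 2 * (real M * h)"
      "\<epsilon> * (cmod (f t))\<^sup>2 + (- 1) * (\<Sum>j\<in>UNIV. (cmod (g j t))\<^sup>2) > 0"
      using h_pos by (rule time_average_pos_imp)
    have "(\<Sum>j\<in>UNIV. (cmod (g j t))\<^sup>2) = (\<Sum>j\<in>UNIV. (cmod (1 - cis (t * \<beta> $ j - x $ j)))\<^sup>2) * (cmod (f t))\<^sup>2"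
      by (simp add: g_eq norm_mult power_mult_distrib sum_distrib_right)
    with t(3) have "(\<Sum>j\<in>UNIV. (cmod (1 - cis (t * \<beta> $ j - x $ j)))\<^sup>2) * (cmod (f t))\<^sup>2 < \<epsilon> * (cmod (f t))\<^sup>2"
      by simp
    then have "(\<Sum>j\<in>UNIV. (cmod (1 - cis (t * \<beta> $ j - x $ j)))\<^sup>2) \<le> \<epsilon>"
      by (meson less_imp_le mult_right_less_imp_less zero_le_power2)
    also have "\<epsilon> \<le> 2 * D / (real P)\<^sup>2"
      unfolding \<epsilon>_def using r1 P D_pos by (intro divide_left_mono) (auto simp: mult_le_cancel_right1)
    also have "\<dots> \<le> C / (real P)\<^sup>2"
      using \<open>\<gamma> > 0\<close> \<beta>_pos by (intro divide_right_mono) (auto simp: C_def)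
    finally have close: "(\<Sum>j\<in>UNIV. (cmod (1 - cis (t * \<beta> $ j - x $ j)))\<^sup>2) \<le> C / (real P)\<^sup>2" .
    have P_powr: "1 \<le> real P powr \<tau>" using P \<open>\<tau> > 0\<close> by (simp add: ge_one_powr_ge_zero)
    have "2 * (real M * h) \<le> 2 * ((16 / (h * s) + 1) * h)"
      using M_le h_pos by simp
    also have "\<dots> = 32 / s + 2 * h" using h_pos s_pos by (simp add: field_simps)
    also have "\<dots> \<le> 32 * (2 * real (N + 1)) powr \<tau> / (\<gamma> * norm \<beta>) + 2"
      using h_le by (simp add: s_def powr_minus field_simps)
    also have "\<dots> \<le> 32 * ((6 * real r) powr \<tau> * real P powr \<tau>) / (\<gamma> * norm \<beta>) + 2"
    proof -
      have "1 \<le> real r * real P" using mult_mono[of 1 "real r" 1 "real P"] r1 P by simp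
      moreover have "real (N + 1) = 2 * (real r * real P) + 1" by (simp add: N_def)
      ultimately have "2 * real (N + 1) \<le> 6 * (real r * real P)" by (simp add: mult.commute)
      also have "\<dots> = 6 * real r * real P" by simp
      finally have "(2 * real (N + 1)) powr \<tau> \<le> (6 * real r * real P) powr \<tau>"
        using \<open>\<tau> > 0\<close> by (intro powr_mono2) auto
      also have "\<dots> = (6 * real r) powr \<tau> * real P powr \<tau>" by (simp add: powr_mult)
      finally show ?thesis
        using \<open>\<gamma> > 0\<close> \<beta>_pos by (intro add_right_mono divide_right_mono mult_left_mono) simp_all
    qed
    also have "\<dots> \<le> C * real P powr \<tau>"
    proof -
      have "2 \<le> (2 + 2 * D) * real P powr \<tau>"
        using mult_mono[of 2 "2 + 2 * D" 1 "real P powr \<tau>"] P_powr D_pos by simp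
      then show ?thesis by (simp add: C_def algebra_simps)
    qed
    finally show ?thesis using t close by (intro exI[of _ t]) auto
  qed
  ultimately show ?thesis by blast
qed

section \<open>Perturbation of a simple resonance\<close>

definition hermitian_inner :: "complex ^ 'n::finite \<Rightarrow> complex ^ 'n \<Rightarrow> complex" where
  "hermitian_inner x y = (\<Sum>i\<in>UNIV. cnj (x $ i) * y $ i)"

lemma hermitian_inner_add_right: "hermitian_inner x (y + z) = hermitian_inner x y + hermitian_inner x z"
  by (simp add: hermitian_inner_def distrib_left sum.distrib)

lemma hermitian_inner_diff_right: "hermitian_inner x (y - z) = hermitian_inner x y - hermitian_inner x z"
  by (simp add: hermitian_inner_def right_diff_distrib sum_subtractf)

lemma hermitian_inner_mult_right: "hermitian_inner x (c *s y) = c * hermitian_inner x y"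
  by (simp add: hermitian_inner_def sum_distrib_left mult_ac)

lemma hermitian_inner_scaleR_right: "hermitian_inner x (c *\<^sub>R y) = c *\<^sub>R hermitian_inner x y"
  by (simp add: hermitian_inner_def scaleR_sum_right)

lemma cnj_hermitian_inner: "cnj (hermitian_inner x y) = hermitian_inner y x"
  by (simp add: hermitian_inner_def mult.commute)

lemma norm_power2_vec: "(norm (x :: complex ^ 'n::finite))\<^sup>2 = (\<Sum>i\<in>UNIV. (cmod (x $ i))\<^sup>2)"
  by (simp add: norm_vec_def L2_set_def sum_nonneg)

lemma hermitian_inner_self: "hermitian_inner x x = complex_of_real ((norm x)\<^sup>2)"
  unfolding norm_power2_vec of_real_sum complex_norm_square
  by (simp add: hermitian_inner_def mult.commute)

lemma norm_hermitian_inner_le: "cmod (hermitian_inner x y) \<le> norm x * norm y"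
proof -
  have "cmod (hermitian_inner x y) \<le> (\<Sum>i\<in>UNIV. \<bar>cmod (x $ i)\<bar> * \<bar>cmod (y $ i)\<bar>)"
    unfolding hermitian_inner_def by (intro sum_norm_le) (simp add: norm_mult)
  also have "\<dots> \<le> norm x * norm y"
    unfolding norm_vec_def by (rule L2_set_mult_ineq)
  finally show ?thesis .
qed

lemma norm_mult_vec: "norm (c *s (x :: complex ^ 'n::finite)) = cmod c * norm x"
  by (simp add: norm_vec_def norm_mult L2_set_right_distrib)

definition phase_mult :: "real ^ 'e \<Rightarrow> complex ^ 'e::finite bond \<Rightarrow> complex ^ 'e bond" where
  "phase_mult \<psi> x = (\<chi> b. cis (\<psi> $ fst b) * x $ b)"

lemma phase_mult_zero: "phase_mult 0 x = x"
  by (simp add: phase_mult_def vec_eq_iff)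

lemma norm_phase_mult: "norm (phase_mult \<psi> x) = norm x"
  by (simp add: norm_vec_def phase_mult_def norm_mult)

lemma norm_phase_mult_diff_le: "norm (phase_mult \<psi> x - phase_mult \<psi>' x) \<le> norm (\<psi> - \<psi>') * norm x"
proof -
  have "cmod ((phase_mult \<psi> x - phase_mult \<psi>' x) $ b) \<le> norm (\<psi> - \<psi>') * cmod (x $ b)" for b
  proof -
    have "cis (\<psi> $ fst b) = cis (\<psi>' $ fst b) * cis ((\<psi> - \<psi>') $ fst b)"
      by (simp add: cis_mult)
    then have "(phase_mult \<psi> x - phase_mult \<psi>' x) $ b
        = - (cis (\<psi>' $ fst b) * (1 - cis ((\<psi> - \<psi>') $ fst b)) * x $ b)"
      by (simp add: phase_mult_def algebra_simps)
    then have "cmod ((phase_mult \<psi> x - phase_mult \<psi>' x) $ b)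
        = cmod (1 - cis ((\<psi> - \<psi>') $ fst b)) * cmod (x $ b)"
      by (simp add: norm_mult)
    also have "\<dots> \<le> norm (\<psi> - \<psi>') * cmod (x $ b)"
      by (intro mult_right_mono order_trans[OF norm_one_minus_cis_le component_le_norm_cart]) auto
    finally show ?thesis .
  qed
  then have "norm (phase_mult \<psi> x - phase_mult \<psi>' x) \<le> L2_set (\<lambda>b. norm (\<psi> - \<psi>') * cmod (x $ b)) UNIV"
    unfolding norm_vec_def[of "phase_mult \<psi> x - phase_mult \<psi>' x"] by (intro L2_set_mono) auto
  then show ?thesis by (simp add: L2_set_right_distrib[symmetric] norm_vec_def[of x])
qed

text \<open>The resonant phase vectors form a hypersurface through \<open>0\<close> that is transversal to every
  positive direction \<open>l\<close>: bordering \<open>1 - D(\<psi>) W\<close> with the projection onto \<open>a\<close> gives an invertible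
  matrix \<open>B \<psi>\<close>, and the hypersurface is the zero set of \<open>\<kappa> = 1 - \<langle>a, c\<rangle>\<close> with \<open>B \<psi> c = a\<close>. By
  unitarity \<open>\<kappa>\<close> runs on a circle tangent to the imaginary axis at \<open>0\<close>, so that it suffices to find
  a zero of its imaginary part, which is \<open>- \<Sum>\<^sub>b \<bar>a\<^sub>b\<bar>\<^sup>2 sin \<psi>\<^sub>b\<close> up to second order.\<close>

lemma resonance_perturbation:
  fixes W :: "complex ^ 'e::finite bond ^ 'e bond" and l :: "real ^ 'e"
  assumes iso: "\<And>x y. hermitian_inner (W *v x) (W *v y) = hermitian_inner x y"
    and fixed: "W *v a = a" and norm_a: "norm a = 1"
    and ker: "\<And>x. W *v x = x \<Longrightarrow> \<exists>c. x = c *s a"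
    and l_pos: "\<And>e. l $ e > 0"
  shows "\<exists>C>0. \<exists>\<delta>>0.
    (\<forall>y. norm y \<le> \<delta> \<longrightarrow> (\<exists>s x. \<bar>s\<bar> \<le> C * norm y \<and> x \<noteq> 0 \<and> phase_mult (y + s *\<^sub>R l) (W *v x) = x)) \<and>
    (\<forall>\<psi> x. phase_mult \<psi> (W *v x) = x \<longrightarrow> (\<exists>k. norm (x - k *s a) \<le> C * norm \<psi> * norm x))"
proof -
  define B where "B \<psi> x = x - phase_mult \<psi> (W *v x) + hermitian_inner a x *s a" for \<psi> x
  have W_norm: "norm (W *v x) = norm x" for x
  proof -
    have "complex_of_real ((norm (W *v x))\<^sup>2) = complex_of_real ((norm x)\<^sup>2)"
      using iso[of x x] by (simp only: hermitian_inner_self)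
    then have "(norm (W *v x))\<^sup>2 = (norm x)\<^sup>2" by (simp only: of_real_eq_iff)
    then show ?thesis by simp
  qed
  have W_inner: "hermitian_inner a (W *v x) = hermitian_inner a x" for x
    using iso[of a x] fixed by simp
  have a_self: "hermitian_inner a a = 1" by (simp add: hermitian_inner_self norm_a)
  have B_linear: "linear (B \<psi>)" for \<psi>
  proof (rule linearI)
    show "B \<psi> (x + y) = B \<psi> x + B \<psi> y" for x y
      by (simp add: B_def phase_mult_def vec_eq_iff matrix_vector_right_distrib hermitian_inner_add_right
          algebra_simps)
    show "B \<psi> (r *\<^sub>R x) = r *\<^sub>R B \<psi> x" for r x
    proof -
      have "W *v (r *\<^sub>R x) = r *\<^sub>R (W *v x)"
        by (simp add: matrix_vector_mult_def vec_eq_iff scaleR_sum_right)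
      then show ?thesis
        unfolding B_def hermitian_inner_scaleR_right
        by (simp add: vec_eq_iff phase_mult_def scaleR_right_diff_distrib scaleR_right_distrib)
    qed
  qed
  have B_diff: "norm (B \<psi> x - B \<psi>' x) \<le> norm (\<psi> - \<psi>') * norm x" for \<psi> \<psi>' x
  proof -
    have "B \<psi> x - B \<psi>' x = phase_mult \<psi>' (W *v x) - phase_mult \<psi> (W *v x)" by (simp add: B_def)
    then show ?thesis
      using norm_phase_mult_diff_le[of \<psi>' "W *v x" \<psi>] by (simp add: W_norm norm_minus_commute)
  qed
  have B0: "B 0 x = x - W *v x + hermitian_inner a x *s a" for x
    by (simp add: B_def phase_mult_zero)
  have B0_a: "B 0 a = a" by (simp add: B0 fixed a_self)
  \<comment> \<open>Unitarity makes the range of 1 - W orthogonal to \<open>a\<close>, so that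
    pairing with \<open>a\<close> isolates the bordering term; what remains is the kernel of 1 - W,
    spanned by \<open>a\<close>.\<close>
  have "inj (B 0)"
  proof (subst linear_injective_0[OF B_linear], intro allI impI)
    fix x assume x: "B 0 x = 0"
    have "hermitian_inner a (B 0 x) = hermitian_inner a x"
      by (simp add: B0 hermitian_inner_add_right hermitian_inner_diff_right hermitian_inner_mult_right W_inner a_self)
    then have ax: "hermitian_inner a x = 0" using x by (simp add: hermitian_inner_def)
    then have "W *v x = x" using x by (simp add: B0)
    then obtain c where "x = c *s a" using ker by blast
    then show "x = 0" using ax by (simp add: hermitian_inner_mult_right a_self)
  qed
  then obtain m where m_pos: "m > 0" and m: "\<And>x. m * norm x \<le> norm (B 0 x)"
    using linear_inj_bounded_below_pos[OF B_linear[of 0]] by metis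
  \<comment> \<open>On the component orthogonal to \<open>a\<close> the bordering term vanishes, so
    \<open>B 0\<close> sends it to x - W x, the difference of two phases applied to the same vector;
    the lower bound m turns this into closeness.\<close>
  have near: "norm (x - hermitian_inner a x *s a) \<le> 1 / m * norm \<psi> * norm x"
    if "phase_mult \<psi> (W *v x) = x" for \<psi> x
  proof -
    let ?y = "x - hermitian_inner a x *s a"
    have "hermitian_inner a ?y = 0"
      by (simp add: hermitian_inner_diff_right hermitian_inner_mult_right a_self)
    moreover have "W *v ?y = W *v x - hermitian_inner a x *s a"
      by (simp add: matrix_vector_mult_diff_distrib vector_scalar_commute fixed)
    ultimately have "B 0 ?y = phase_mult \<psi> (W *v x) - phase_mult 0 (W *v x)"
      by (simp add: B0 that phase_mult_zero)
    then have "norm (B 0 ?y) \<le> norm \<psi> * norm x"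
      using norm_phase_mult_diff_le[of \<psi> "W *v x" 0] by (simp add: W_norm)
    then show ?thesis using m[of ?y] m_pos by (simp add: field_simps)
  qed
  have B_below: "m / 2 * norm x \<le> norm (B \<psi> x)" if "norm \<psi> \<le> m / 2" for \<psi> x
  proof -
    have "norm (B \<psi> x - B 0 x) \<le> m / 2 * norm x"
      using B_diff[of \<psi> x 0] mult_right_mono[OF that, of "norm x"] by simp
    then show ?thesis using m[of x] norm_triangle_ineq2[of "B 0 x" "B \<psi> x"]
      by (simp add: norm_minus_commute)
  qed
  \<comment> \<open>Meaningful where \<open>B \<psi>\<close> is onto, which norm \<psi> \<le> m / 2
    guarantees: the perturbation of \<open>B 0\<close> is then at most half of its lower
    bound.\<close>
  define c where "c \<psi> = (SOME x. B \<psi> x = a)" for \<psi>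
  have Bc: "B \<psi> (c \<psi>) = a" if "norm \<psi> \<le> m / 2" for \<psi>
  proof -
    have "inj (B \<psi>)"
    proof (subst linear_injective_0[OF B_linear], intro allI impI)
      fix x assume "B \<psi> x = 0"
      then show "x = 0" using B_below[OF that, of x] m_pos by (simp add: mult_le_0_iff)
    qed
    then have "surj (B \<psi>)" by (rule linear_inj_imp_surj[OF B_linear])
    then show ?thesis unfolding c_def by (metis (mono_tags) someI_ex surjD)
  qed
  have c_norm: "norm (c \<psi>) \<le> 2 / m" if "norm \<psi> \<le> m / 2" for \<psi>
    using B_below[OF that, of "c \<psi>"] m_pos by (simp add: Bc[OF that] norm_a field_simps)
  have c_lip: "norm (c \<psi> - c \<psi>') \<le> (2 / m)\<^sup>2 * norm (\<psi> - \<psi>')"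
    if "norm \<psi> \<le> m / 2" "norm \<psi>' \<le> m / 2" for \<psi> \<psi>'
  proof -
    have "m / 2 * norm (c \<psi> - c \<psi>') \<le> norm (B \<psi> (c \<psi> - c \<psi>'))" by (rule B_below) fact
    also have "B \<psi> (c \<psi> - c \<psi>') = B \<psi>' (c \<psi>') - B \<psi> (c \<psi>')"
      by (simp add: linear_diff[OF B_linear] Bc[OF that(1)] Bc[OF that(2)])
    also have "norm \<dots> \<le> norm (\<psi> - \<psi>') * norm (c \<psi>')"
      using B_diff[of \<psi>' "c \<psi>'" \<psi>] by (simp add: norm_minus_commute)
    also have "\<dots> \<le> norm (\<psi> - \<psi>') * (2 / m)" by (intro mult_left_mono c_norm that) auto
    finally show ?thesis using m_pos by (simp add: field_simps power2_eq_square)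
  qed
  have c0: "c 0 = a"
  proof -
    have "B 0 (c 0 - a) = 0" using m_pos by (simp add: linear_diff[OF B_linear] Bc B0_a)
    then show ?thesis using m[of "c 0 - a"] m_pos by (simp add: mult_le_0_iff)
  qed
  define \<kappa> where "\<kappa> \<psi> = 1 - hermitian_inner a (c \<psi>)" for \<psi>
  have c_eq: "phase_mult \<psi> (W *v c \<psi>) = c \<psi> - \<kappa> \<psi> *s a" if "norm \<psi> \<le> m / 2" for \<psi>
    using Bc[OF that] by (simp add: B_def \<kappa>_def vector_ssub_ldistrib vector_sub_rdistrib algebra_simps)
  \<comment> \<open>W followed by phases preserves norms, so \<open>c \<psi>\<close> and c -
    \<kappa> a have equal length. Expanding gives the circle with centre 1/3 and radius 1/3.\<close>
  have \<kappa>_circle: "2 * Re (\<kappa> \<psi>) = 3 * (cmod (\<kappa> \<psi>))\<^sup>2" if "norm \<psi> \<le> m / 2" for \<psi>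
  proof -
    have ac: "hermitian_inner a (c \<psi>) = 1 - \<kappa> \<psi>" by (simp add: \<kappa>_def)
    have ca: "hermitian_inner (c \<psi>) a = 1 - cnj (\<kappa> \<psi>)"
      using ac cnj_hermitian_inner[of a "c \<psi>"] by simp
    let ?y = "c \<psi> - \<kappa> \<psi> *s a"
    have "norm ?y = norm (c \<psi>)" using c_eq[OF that] by (metis norm_phase_mult W_norm)
    then have eq: "hermitian_inner ?y ?y = hermitian_inner (c \<psi>) (c \<psi>)" by (simp add: hermitian_inner_self)
    have ya: "hermitian_inner ?y a = 1 - 2 * cnj (\<kappa> \<psi>)"
    proof -
      have "hermitian_inner ?y a = cnj (hermitian_inner a ?y)" by (simp add: cnj_hermitian_inner)
      then show ?thesis by (simp add: hermitian_inner_diff_right hermitian_inner_mult_right ac a_self)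
    qed
    have yc: "hermitian_inner ?y (c \<psi>) = hermitian_inner (c \<psi>) (c \<psi>) - cnj (\<kappa> \<psi>) * (1 - \<kappa> \<psi>)"
    proof -
      have "hermitian_inner ?y (c \<psi>) = cnj (hermitian_inner (c \<psi>) ?y)" by (simp add: cnj_hermitian_inner)
      then show ?thesis
        by (simp add: hermitian_inner_diff_right hermitian_inner_mult_right ca cnj_hermitian_inner)
    qed
    have "hermitian_inner ?y ?y = hermitian_inner ?y (c \<psi>) - \<kappa> \<psi> * hermitian_inner ?y a"
      by (simp only: hermitian_inner_diff_right hermitian_inner_mult_right)
    then have "cnj (\<kappa> \<psi>) * (1 - \<kappa> \<psi>) + \<kappa> \<psi> * (1 - 2 * cnj (\<kappa> \<psi>)) = 0"
      unfolding eq ya yc by (simp add: algebra_simps)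
    then have "Re (cnj (\<kappa> \<psi>) * (1 - \<kappa> \<psi>) + \<kappa> \<psi> * (1 - 2 * cnj (\<kappa> \<psi>))) = 0" by simp
    then show ?thesis unfolding cmod_power2 by (simp add: algebra_simps power2_eq_square)
  qed
  \<comment> \<open>Replacing \<open>W *v c \<psi>\<close> by \<open>a\<close> is an error of order
    norm \<psi>, and 1 minus the phase supplies the second such factor.\<close>
  have \<kappa>_expand: "cmod (\<kappa> \<psi> - (\<Sum>b\<in>UNIV. (cmod (a $ b))\<^sup>2 * (1 - cis (\<psi> $ fst b)))) \<le> (2 / m)\<^sup>2 * (norm \<psi>)\<^sup>2"
    if \<psi>: "norm \<psi> \<le> m / 2" for \<psi>
  proof -
    let ?d = "W *v c \<psi> - a"
    have "\<kappa> \<psi> = hermitian_inner a (c \<psi> - phase_mult \<psi> (W *v c \<psi>))"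
      unfolding c_eq[OF \<psi>] by (simp add: hermitian_inner_mult_right a_self)
    also have "\<dots> = hermitian_inner a (W *v c \<psi> - phase_mult \<psi> (W *v c \<psi>))"
      by (simp add: hermitian_inner_diff_right W_inner)
    also have "W *v c \<psi> - phase_mult \<psi> (W *v c \<psi>) = (a - phase_mult \<psi> a) + (?d - phase_mult \<psi> ?d)"
      by (simp add: phase_mult_def vec_eq_iff right_diff_distrib)
    also have "hermitian_inner a \<dots> = hermitian_inner a (a - phase_mult \<psi> a) + hermitian_inner a (?d - phase_mult \<psi> ?d)"
      by (rule hermitian_inner_add_right)
    also have "hermitian_inner a (a - phase_mult \<psi> a) = (\<Sum>b\<in>UNIV. (cmod (a $ b))\<^sup>2 * (1 - cis (\<psi> $ fst b)))"
      unfolding complex_norm_square by (simp add: hermitian_inner_def phase_mult_def algebra_simps)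
    finally have "cmod (\<kappa> \<psi> - (\<Sum>b\<in>UNIV. (cmod (a $ b))\<^sup>2 * (1 - cis (\<psi> $ fst b))))
        = cmod (hermitian_inner a (?d - phase_mult \<psi> ?d))" by simp
    also have "\<dots> \<le> norm a * norm (?d - phase_mult \<psi> ?d)" by (rule norm_hermitian_inner_le)
    also have "\<dots> \<le> norm \<psi> * norm ?d"
      using norm_phase_mult_diff_le[of 0 ?d \<psi>] by (simp add: norm_a phase_mult_zero)
    also have "\<dots> \<le> norm \<psi> * ((2 / m)\<^sup>2 * norm \<psi>)"
    proof (rule mult_left_mono)
      have "?d = W *v (c \<psi> - c 0)" by (simp add: matrix_vector_mult_diff_distrib c0 fixed)
      then show "norm ?d \<le> (2 / m)\<^sup>2 * norm \<psi>"
        using c_lip[of \<psi> 0] \<psi> m_pos by (simp only: W_norm) simp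
    qed simp
    finally show ?thesis by (simp only: power2_eq_square mult_ac)
  qed
  define l0 where "l0 = Min (range (($) l))"
  have l0_pos: "l0 > 0" and l0_le: "l0 \<le> l $ e" for e
    using l_pos by (auto simp: l0_def)
  define R where "R = 1 + 3 / l0 * norm l"
  have R_pos: "R > 0" using l0_pos by (simp add: R_def add_pos_nonneg)
  define \<delta> where "\<delta> = min (1 / ((2 / m)\<^sup>2 * R\<^sup>2)) (min (1 / R) (m / (4 * R)))"
  have "\<delta> > 0" using R_pos m_pos by (simp add: \<delta>_def)
  define C where "C = max (3 / l0) (1 / m)"
  have "C > 0" using m_pos by (simp add: C_def less_max_iff_disj)
  have "\<exists>s x. \<bar>s\<bar> \<le> C * norm y \<and> x \<noteq> 0 \<and> phase_mult (y + s *\<^sub>R l) (W *v x) = x"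
    if y: "norm y \<le> \<delta>" for y
  proof -
    \<comment> \<open>At s = S and s = - S every phase is at least 2 norm y in modulus, with the
      sign of s: the shift contributes 3 norm y and y takes back at most norm y. Its sine is then at
      least norm y in modulus and offsets the error.\<close>
    define S where "S = 3 / l0 * norm y"
    have S_nonneg: "0 \<le> S" using l0_pos by (simp add: S_def)
    have \<psi>_norm: "norm (y + s *\<^sub>R l) \<le> R * norm y" if "\<bar>s\<bar> \<le> S" for s
    proof -
      have "norm (y + s *\<^sub>R l) \<le> norm y + \<bar>s\<bar> * norm l"
        using norm_triangle_ineq[of y "s *\<^sub>R l"] by simp
      also have "\<dots> \<le> norm y + S * norm l" using that by (simp add: mult_right_mono)
      also have "\<dots> = R * norm y" by (simp add: S_def R_def algebra_simps)
      finally show ?thesis .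
    qed
    have Ry: "R * norm y \<le> 1" "R * norm y \<le> m / 4" "(2 / m)\<^sup>2 * (R * norm y)\<^sup>2 \<le> norm y"
    proof -
      have "R * norm y \<le> R * (1 / R)" "R * norm y \<le> R * (m / (4 * R))"
        using y R_pos unfolding \<delta>_def by (intro mult_left_mono; simp)+
      then show "R * norm y \<le> 1" "R * norm y \<le> m / 4" using R_pos by simp_all
      have "(2 / m)\<^sup>2 * R\<^sup>2 * norm y \<le> (2 / m)\<^sup>2 * R\<^sup>2 * (1 / ((2 / m)\<^sup>2 * R\<^sup>2))"
        using y unfolding \<delta>_def by (intro mult_left_mono) auto
      also have "\<dots> = 1" using R_pos m_pos by simp
      finally have "(2 / m)\<^sup>2 * R\<^sup>2 * norm y * norm y \<le> 1 * norm y" by (rule mult_right_mono) auto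
      then show "(2 / m)\<^sup>2 * (R * norm y)\<^sup>2 \<le> norm y" by (simp add: power2_eq_square mult_ac)
    qed
    have \<psi>_small: "norm (y + s *\<^sub>R l) \<le> 1" "norm (y + s *\<^sub>R l) \<le> m / 4"
      "(2 / m)\<^sup>2 * (norm (y + s *\<^sub>R l))\<^sup>2 \<le> norm y" if "\<bar>s\<bar> \<le> S" for s
    proof -
      show "norm (y + s *\<^sub>R l) \<le> 1" "norm (y + s *\<^sub>R l) \<le> m / 4"
        using \<psi>_norm[OF that] Ry by linarith+
      have "(2 / m)\<^sup>2 * (norm (y + s *\<^sub>R l))\<^sup>2 \<le> (2 / m)\<^sup>2 * (R * norm y)\<^sup>2"
        using \<psi>_norm[OF that] by (intro mult_left_mono power_mono) auto
      then show "(2 / m)\<^sup>2 * (norm (y + s *\<^sub>R l))\<^sup>2 \<le> norm y" using Ry by linarith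
    qed
    have \<psi>_half: "norm (y + s *\<^sub>R l) \<le> m / 2" if "\<bar>s\<bar> \<le> S" for s
      using \<psi>_small(2)[OF that] m_pos by linarith
    define g where "g s = Im (\<kappa> (y + s *\<^sub>R l))" for s
    define w where "w s = (\<Sum>b\<in>UNIV. (cmod (a $ b))\<^sup>2 * sin ((y + s *\<^sub>R l) $ fst b))" for s
    have g_w: "\<bar>g s + w s\<bar> \<le> norm y" if "\<bar>s\<bar> \<le> S" for s
    proof -
      let ?\<psi> = "y + s *\<^sub>R l"
      have "g s + w s = Im (\<kappa> ?\<psi> - (\<Sum>b\<in>UNIV. (cmod (a $ b))\<^sup>2 * (1 - cis (?\<psi> $ fst b))))"
        by (simp add: g_def w_def sum_negf)
      then have "\<bar>g s + w s\<bar> \<le> cmod (\<kappa> ?\<psi> - (\<Sum>b\<in>UNIV. (cmod (a $ b))\<^sup>2 * (1 - cis (?\<psi> $ fst b))))"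
        by (simp only: abs_Im_le_cmod)
      also note \<kappa>_expand[OF \<psi>_half[OF that]]
      also note \<psi>_small(3)[OF that]
      finally show ?thesis .
    qed
    have a_sum: "(\<Sum>b\<in>UNIV. (cmod (a $ b))\<^sup>2) = 1"
      using norm_a by (simp flip: norm_power2_vec)
    have y_comp: "\<bar>y $ e\<bar> \<le> norm y" for e by (rule component_le_norm_cart)
    have S_l: "3 * norm y \<le> S * l $ e" for e
      using mult_left_mono[OF l0_le[of e] S_nonneg] l0_pos by (simp add: S_def)
    have half: "(y + s *\<^sub>R l) $ e \<le> pi / 2" "- (pi / 2) \<le> (y + s *\<^sub>R l) $ e" if "\<bar>s\<bar> \<le> S" for s e
      using component_le_norm_cart[of "y + s *\<^sub>R l" e] \<psi>_small(1)[OF that] pi_ge_two by linarith+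
    have w_S: "norm y \<le> w S"
    proof -
      have "norm y = (\<Sum>b\<in>UNIV. (cmod (a $ b))\<^sup>2 * norm y)" by (simp flip: sum_distrib_right add: a_sum)
      also have "\<dots> \<le> w S"
        unfolding w_def
      proof (intro sum_mono mult_left_mono)
        fix b :: "'e bond"
        have "2 * norm y \<le> (y + S *\<^sub>R l) $ fst b" using S_l[of "fst b"] y_comp[of "fst b"] by simp
        moreover have "(y + S *\<^sub>R l) $ fst b / 2 \<le> sin ((y + S *\<^sub>R l) $ fst b)"
        proof (rule sin_ge_half)
          show "0 \<le> (y + S *\<^sub>R l) $ fst b" using calculation norm_ge_zero[of y] by linarith
          show "(y + S *\<^sub>R l) $ fst b \<le> pi / 2" by (rule half) (use S_nonneg in simp)
        qed
        ultimately show "norm y \<le> sin ((y + S *\<^sub>R l) $ fst b)" by linarith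
      qed auto
      finally show ?thesis .
    qed
    have w_minus_S: "w (- S) \<le> - norm y"
    proof -
      have "w (- S) \<le> (\<Sum>b\<in>UNIV. (cmod (a $ b))\<^sup>2 * (- norm y))"
        unfolding w_def
      proof (intro sum_mono mult_left_mono)
        fix b :: "'e bond"
        have "2 * norm y \<le> - ((y + (- S) *\<^sub>R l) $ fst b)" using S_l[of "fst b"] y_comp[of "fst b"] by simp
        moreover have "- ((y + (- S) *\<^sub>R l) $ fst b) / 2 \<le> sin (- ((y + (- S) *\<^sub>R l) $ fst b))"
        proof (rule sin_ge_half)
          show "0 \<le> - ((y + (- S) *\<^sub>R l) $ fst b)" using calculation norm_ge_zero[of y] by linarith
          have "- (pi / 2) \<le> (y + (- S) *\<^sub>R l) $ fst b" by (rule half) (use S_nonneg in simp)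
          then show "- ((y + (- S) *\<^sub>R l) $ fst b) \<le> pi / 2" by linarith
        qed
        ultimately show "sin ((y + (- S) *\<^sub>R l) $ fst b) \<le> - norm y" unfolding sin_minus by linarith
      qed auto
      also have "\<dots> = - norm y" by (simp flip: sum_distrib_right add: a_sum sum_negf)
      finally show ?thesis .
    qed
    have "continuous_on {- S..S} g"
    proof (rule lipschitz_on_continuous_on[of "(2 / m)\<^sup>2 * norm l"], rule lipschitz_onI)
      fix s s' assume s: "s \<in> {- S..S}" "s' \<in> {- S..S}"
      have "dist (g s) (g s') = \<bar>Im (\<kappa> (y + s *\<^sub>R l) - \<kappa> (y + s' *\<^sub>R l))\<bar>"
        by (simp add: g_def dist_real_def)
      also have "\<dots> \<le> cmod (\<kappa> (y + s *\<^sub>R l) - \<kappa> (y + s' *\<^sub>R l))" by (rule abs_Im_le_cmod)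
      also have "\<dots> = cmod (hermitian_inner a (c (y + s' *\<^sub>R l) - c (y + s *\<^sub>R l)))"
        by (simp add: \<kappa>_def hermitian_inner_diff_right)
      also have "\<dots> \<le> norm (c (y + s' *\<^sub>R l) - c (y + s *\<^sub>R l))"
        using norm_hermitian_inner_le[of a] by (simp add: norm_a)
      also have "\<dots> \<le> (2 / m)\<^sup>2 * norm ((y + s' *\<^sub>R l) - (y + s *\<^sub>R l))"
        using s by (intro c_lip \<psi>_half) auto
      also have "(y + s' *\<^sub>R l) - (y + s *\<^sub>R l) = (s' - s) *\<^sub>R l" by (simp add: scaleR_left_diff_distrib)
      also have "(2 / m)\<^sup>2 * norm \<dots> = (2 / m)\<^sup>2 * norm l * dist s s'" by (simp add: dist_real_def abs_minus_commute)
      finally show "dist (g s) (g s') \<le> (2 / m)\<^sup>2 * norm l * dist s s'" .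
    qed simp
    moreover have "g S \<le> 0" "0 \<le> g (- S)"
      using g_w[of S] g_w[of "- S"] w_S w_minus_S S_nonneg by auto
    ultimately obtain s where s: "- S \<le> s" "s \<le> S" "g s = 0"
      using IVT2'[of g S 0 "- S"] S_nonneg by auto
    let ?\<psi> = "y + s *\<^sub>R l"
    have s_abs: "\<bar>s\<bar> \<le> S" using s by simp
    note \<psi> = \<psi>_half[OF s_abs]
    \<comment> \<open>A real point of the circle is 0 or 2/3, and the bound 1/2 excludes the
      latter.\<close>
    have "\<kappa> ?\<psi> = 0"
    proof -
      have "\<kappa> ?\<psi> = hermitian_inner a (W *v c ?\<psi> - phase_mult ?\<psi> (W *v c ?\<psi>))"
        by (simp add: c_eq[OF \<psi>] hermitian_inner_diff_right hermitian_inner_mult_right W_inner a_self)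
      then have "cmod (\<kappa> ?\<psi>) \<le> norm a * norm (W *v c ?\<psi> - phase_mult ?\<psi> (W *v c ?\<psi>))"
        using norm_hermitian_inner_le by (simp only:)
      also have "\<dots> = norm (phase_mult 0 (W *v c ?\<psi>) - phase_mult ?\<psi> (W *v c ?\<psi>))"
        by (simp only: norm_a phase_mult_zero mult_1)
      also have "\<dots> \<le> norm (0 - ?\<psi>) * norm (W *v c ?\<psi>)" by (rule norm_phase_mult_diff_le)
      also have "\<dots> = norm ?\<psi> * norm (c ?\<psi>)" by (simp only: W_norm diff_0 norm_minus_cancel)
      also have "\<dots> \<le> m / 4 * (2 / m)"
        using \<psi>_small(2)[OF s_abs] c_norm[OF \<psi>] m_pos by (intro mult_mono) auto
      finally have "cmod (\<kappa> ?\<psi>) < 2 / 3" using m_pos by simp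
      moreover have "cmod (\<kappa> ?\<psi>) = \<bar>Re (\<kappa> ?\<psi>)\<bar>"
        using s(3) by (simp add: g_def cmod_def)
      ultimately have "\<bar>Re (\<kappa> ?\<psi>)\<bar> < 2 / 3" "2 * Re (\<kappa> ?\<psi>) = 3 * (Re (\<kappa> ?\<psi>))\<^sup>2"
        using \<kappa>_circle[OF \<psi>] by auto
      then have "Re (\<kappa> ?\<psi>) = 0" by (auto simp: power2_eq_square)
      then show ?thesis using s(3) by (simp add: g_def complex_eq_iff)
    qed
    \<comment> \<open>Nonzero because its inner product with \<open>a\<close> is now 1.\<close>
    then have "phase_mult ?\<psi> (W *v c ?\<psi>) = c ?\<psi>" "c ?\<psi> \<noteq> 0"
      using c_eq[OF \<psi>] by (auto simp: \<kappa>_def hermitian_inner_def)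
    moreover have "\<bar>s\<bar> \<le> C * norm y"
      using s_abs mult_right_mono[of "3 / l0" C "norm y"] by (simp add: C_def S_def)
    ultimately show ?thesis by blast
  qed
  moreover have "\<exists>k. norm (x - k *s a) \<le> C * norm \<psi> * norm x" if "phase_mult \<psi> (W *v x) = x" for \<psi> x
  proof -
    have "1 / m * norm \<psi> * norm x \<le> C * norm \<psi> * norm x"
      by (intro mult_right_mono) (auto simp: C_def)
    then show ?thesis using near[OF that] order_trans by blast
  qed
  ultimately show ?thesis using \<open>C > 0\<close> \<open>\<delta> > 0\<close> by blast
qed

section \<open>Eigenfunctions from bond amplitudes\<close>

lemma set_integrable_open_interval:
  fixes f :: "real \<Rightarrow> 'a::euclidean_space"
  assumes "continuous_on {a..b} f"
  shows "set_integrable lborel {a<..<b} f"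
  by (rule set_integrable_subset[OF borel_integrable_atLeastAtMost'[OF assms]]) auto

lemma LINT_open_interval:
  fixes f :: "real \<Rightarrow> 'a::euclidean_space"
  assumes "continuous_on {a..b} f"
  shows "(LINT x:{a<..<b}|lborel. f x) = integral {a..b} f"
  using set_borel_integral_eq_integral(2)[OF set_integrable_open_interval[OF assms]]
  by (simp add: integral_open_interval_real)

lemma L2_if_continuous:
  assumes "\<And>e. continuous_on {0..l $ e} (u e)"
  shows "u \<in> L2 l"
  unfolding L2_def
proof (intro CollectI allI conjI)
  fix e
  show "set_borel_measurable lborel {0<..<l $ e} (u e)"
    using set_integrable_open_interval[OF assms[of e]]
    unfolding set_integrable_def set_borel_measurable_def by (rule borel_measurable_integrable)
  show "set_integrable lborel {0<..<l $ e} (\<lambda>x. (cmod (u e x))\<^sup>2)"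
    by (intro set_integrable_open_interval continuous_intros assms)
qed

section \<open>Scattering at a vertex and its unitarity\<close>

lemma bond_reverse_simps [simp]:
  "bond_reverse (bond_reverse b) = b" "fst (bond_reverse b) = fst b"
  "bond_start G (bond_reverse b) = bond_end G b" "bond_end G (bond_reverse b) = bond_start G b"
  by (auto simp: bond_reverse_def bond_start_def bond_end_def)

lemma bij_bond_reverse: "bij bond_reverse"
  by (rule o_bij[of bond_reverse]) (auto simp: fun_eq_iff)

lemma sum_bond_end:
  "(\<Sum>b' | bond_end G b' = v. f b') = (\<Sum>b | bond_start G b = v. f (bond_reverse b))"
  by (rule sum.reindex_bij_witness[of _ bond_reverse bond_reverse]) auto

lemma exterior_unique:
  assumes "exterior G (bond_start G b)" "bond_start G b' = bond_start G b"
  shows "b' = b"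
proof -
  obtain c where c: "{b'. bond_start G b' = bond_start G b} = {c}"
    using assms(1) unfolding exterior_def degree_def by (metis card_1_singletonE)
  have "b \<in> {c}" "b' \<in> {c}" unfolding c[symmetric] using assms(2) by auto
  then show ?thesis by simp
qed

lemma scattering_exterior:
  assumes "exterior G (bond_start G b)"
  shows "(bond_scattering G *v x) $ b =
    (case bc G (bond_start G b) of Dirichlet \<Rightarrow> - x $ bond_reverse b | Neumann \<Rightarrow> x $ bond_reverse b)"
proof -
  have unique: "bond_end G b' = bond_start G b \<longleftrightarrow> b' = bond_reverse b" for b'
    using exterior_unique[OF assms, of "bond_reverse b'"] by auto
  have "(bond_scattering G *v x) $ b
      = (\<Sum>b'\<in>UNIV. if b' = bond_reverse b then (case bc G (bond_start G b) of Dirichlet \<Rightarrow> - x $ b' | Neumann \<Rightarrow> x $ b') else 0)"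
    unfolding matrix_vector_mult_def bond_scattering_def vec_lambda_beta
    by (intro sum.cong) (auto simp: unique assms split: bcond.split)
  then show ?thesis by simp
qed

lemma scattering_interior:
  assumes "\<not> exterior G (bond_start G b)"
  shows "(bond_scattering G *v x) $ b =
    2 / of_nat (degree G (bond_start G b)) * (\<Sum>b' | bond_end G b' = bond_start G b. x $ b') - x $ bond_reverse b"
proof -
  let ?c = "2 / of_nat (degree G (bond_start G b)) :: complex"
  have "(bond_scattering G *v x) $ b
      = (\<Sum>b'\<in>UNIV. (if bond_end G b' = bond_start G b then ?c * x $ b' else 0) - (if b' = bond_reverse b then x $ b' else 0))"
    unfolding matrix_vector_mult_def bond_scattering_def vec_lambda_beta
    by (intro sum.cong) (auto simp: assms left_diff_distrib)
  then show ?thesis by (simp add: sum_subtractf sum_distrib_left flip: sum.inter_filter)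
qed

text \<open>Bonds are grouped by initial vertex. At an interior vertex of degree d the block acts on
  the incoming amplitudes as 2/d times the all-ones matrix minus the identity, a reflection; in the
  expansion the square term, d times 4/d^2, cancels the two mixed terms 2/d.\<close>

lemma hermitian_inner_scattering:
  fixes G :: "('v::finite, 'e::finite) qgraph"
  shows "hermitian_inner (bond_scattering G *v x) (bond_scattering G *v y) = hermitian_inner x y"
proof -
  let ?S = "\<lambda>x. bond_scattering G *v x"
  have vertex: "(\<Sum>b | bond_start G b = v. cnj (?S x $ b) * ?S y $ b)
      = (\<Sum>b | bond_start G b = v. cnj (x $ bond_reverse b) * y $ bond_reverse b)" (is "?L = ?R") for v
  proof (cases "exterior G v")
    case True
    then show ?thesis
      by (intro sum.cong) (auto simp: scattering_exterior split: bcond.split)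
  next
    case False
    let ?d = "of_nat (degree G v) :: complex"
    define X where "X = (\<Sum>b | bond_start G b = v. x $ bond_reverse b)"
    define Y where "Y = (\<Sum>b | bond_start G b = v. y $ bond_reverse b)"
    have "?L = (\<Sum>b | bond_start G b = v.
        cnj (2 / ?d * X - x $ bond_reverse b) * (2 / ?d * Y - y $ bond_reverse b))"
      using False by (intro sum.cong) (auto simp: scattering_interior sum_bond_end X_def Y_def)
    also have "\<dots> = (\<Sum>b | bond_start G b = v. 4 / ?d\<^sup>2 * (cnj X * Y) - 2 / ?d * cnj X * y $ bond_reverse b
        - cnj (x $ bond_reverse b) * (2 / ?d * Y) + cnj (x $ bond_reverse b) * y $ bond_reverse b)"
      by (intro sum.cong) (auto simp: algebra_simps power2_eq_square)
    also have "\<dots> = ?d * (4 / ?d\<^sup>2 * (cnj X * Y)) - 2 / ?d * cnj X * Y - cnj X * (2 / ?d * Y) + ?R"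
    proof -
      have "(\<Sum>b | bond_start G b = v. 4 / ?d\<^sup>2 * (cnj X * Y)) = ?d * (4 / ?d\<^sup>2 * (cnj X * Y))"
        by (simp add: degree_def)
      moreover have "(\<Sum>b | bond_start G b = v. 2 / ?d * cnj X * y $ bond_reverse b) = 2 / ?d * cnj X * Y"
        by (simp add: Y_def sum_distrib_left)
      moreover have "(\<Sum>b | bond_start G b = v. cnj (x $ bond_reverse b) * (2 / ?d * Y)) = cnj X * (2 / ?d * Y)"
        unfolding X_def cnj_sum sum_distrib_right ..
      ultimately show ?thesis by (simp only: sum.distrib sum_subtractf)
    qed
    \<comment> \<open>At an isolated vertex, d = 0, the fractions are 0 and so is every term
      containing them.\<close>
    also have "\<dots> = ?R"
      by (cases "?d = 0") (auto simp: power2_eq_square field_simps)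
    finally show ?thesis .
  qed
  have group: "(\<Sum>v\<in>UNIV. \<Sum>b | bond_start G b = v. f b) = (\<Sum>b\<in>UNIV. f b)" for f :: "'e bond \<Rightarrow> complex"
    using sum.group[of UNIV UNIV "bond_start G" f] by simp
  have "hermitian_inner (?S x) (?S y) = (\<Sum>v\<in>UNIV. \<Sum>b | bond_start G b = v. cnj (x $ bond_reverse b) * y $ bond_reverse b)"
    unfolding hermitian_inner_def by (subst group[symmetric]) (simp add: vertex)
  also have "\<dots> = hermitian_inner x y"
    unfolding group hermitian_inner_def by (rule sum.reindex_bij_betw[OF bij_bond_reverse])
  finally show ?thesis .
qed

lemma bond_evolution_mult: "(bond_evolution G \<theta> *v x) $ b = \<theta> $ fst b * (bond_scattering G *v x) $ b"
  unfolding bond_evolution_def matrix_vector_mul_assoc[symmetric]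
  by (simp add: bond_phases_def matrix_vector_mult_def[of "vec_lambda _"] if_distrib[of "\<lambda>x. x * _"] cong: if_cong)

lemma hermitian_inner_bond_evolution:
  fixes G :: "('v::finite, 'e::finite) qgraph"
  assumes "\<theta> \<in> torus"
  shows "hermitian_inner (bond_evolution G \<theta> *v x) (bond_evolution G \<theta> *v y) = hermitian_inner x y"
proof -
  have "cnj (\<theta> $ e) * \<theta> $ e = 1" for e
    using assms complex_norm_square[of "\<theta> $ e"] by (simp add: torus_def mult.commute)
  then have "cnj (\<theta> $ e * z) * (\<theta> $ e * w) = cnj z * w" for e z w
    by (simp add: mult.assoc mult.left_commute[of "cnj z"])
  then show ?thesis
    using hermitian_inner_scattering[of G x y] by (simp only: hermitian_inner_def bond_evolution_mult)
qed

lemma bond_evolution_torus_class_add: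
  "bond_evolution G (torus_class (\<phi> + \<psi>)) *v x = phase_mult \<psi> (bond_evolution G (torus_class \<phi>) *v x)"
  by (simp add: vec_eq_iff bond_evolution_mult phase_mult_def torus_class_def cis_mult[symmetric] mult_ac)

text \<open>The amplitude \<open>a $ b\<close> is the one of the wave along \<open>b\<close> at the end of \<open>b\<close>.\<close>

definition bond_wave :: "real ^ 'e \<Rightarrow> real \<Rightarrow> complex ^ 'e::finite bond \<Rightarrow> 'e gfun" where
  "bond_wave l k a e x = a $ (e, True) * cis (k * (x - l $ e)) + a $ (e, False) * cis (- (k * x))"

definition bond_wave_deriv :: "real ^ 'e \<Rightarrow> real \<Rightarrow> complex ^ 'e::finite bond \<Rightarrow> 'e gfun" where
  "bond_wave_deriv l k a e x =
     \<i> * of_real k * (a $ (e, True) * cis (k * (x - l $ e)) - a $ (e, False) * cis (- (k * x)))"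

lemma has_vector_derivative_bond_wave:
  "(bond_wave l k a e has_vector_derivative bond_wave_deriv l k a e x) (at x within S)"
  unfolding bond_wave_def[abs_def] bond_wave_deriv_def cis_conv_exp of_real_mult of_real_diff of_real_minus
  by (rule has_vector_derivative_real_field) (auto intro!: derivative_eq_intros simp: algebra_simps)

lemma has_vector_derivative_bond_wave_deriv:
  "(bond_wave_deriv l k a e has_vector_derivative - (of_real (k\<^sup>2) * bond_wave l k a e x)) (at x within S)"
  unfolding bond_wave_def bond_wave_deriv_def[abs_def] cis_conv_exp of_real_mult of_real_diff of_real_minus
  by (rule has_vector_derivative_real_field)
    (auto intro!: derivative_eq_intros simp: algebra_simps power2_eq_square)

lemma end_value_bond_wave:
  "end_value l (bond_wave l k a) b = cis (- (k * l $ fst b)) * a $ b + a $ bond_reverse b"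
  by (cases b) (auto simp: end_value_def bond_wave_def bond_reverse_def)

lemma end_normal_bond_wave:
  "end_normal l (bond_wave_deriv l k a) b = \<i> * of_real k * (a $ bond_reverse b - cis (- (k * l $ fst b)) * a $ b)"
  by (cases b) (auto simp: end_normal_def bond_wave_deriv_def bond_reverse_def algebra_simps)

text \<open>By the fixed point equation the wave leaving along b, of amplitude
  \<open>cis (- (k * l $ fst b)) * a $ b\<close> at the start of b, is the scattered incoming one.
  End values are sums, and normal derivatives multiples of differences, of incoming and outgoing
  amplitudes; interior scattering thus gives the common value 2 X / d and zero total flux.\<close>

lemma vertex_conditions_bond_wave:
  fixes G :: "('v::finite, 'e::finite) qgraph"
  assumes "bond_evolution G (torus_class (k *\<^sub>R l)) *v a = a"
  shows "vertex_conditions G l (bond_wave l k a) (bond_wave_deriv l k a)"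
proof -
  have out: "cis (- (k * l $ fst b)) * a $ b = (bond_scattering G *v a) $ b" for b
  proof -
    have "a $ b = (bond_evolution G (torus_class (k *\<^sub>R l)) *v a) $ b" by (simp only: assms)
    also have "\<dots> = cis (k * l $ fst b) * (bond_scattering G *v a) $ b"
      by (simp add: bond_evolution_mult) (simp add: torus_class_def)
    finally show ?thesis by (simp add: cis_mult flip: mult.assoc)
  qed
  show ?thesis
    unfolding vertex_conditions_def
  proof (intro allI)
    fix v
    let ?d = "of_nat (degree G v) :: complex"
    define X where "X = (\<Sum>b | bond_start G b = v. a $ bond_reverse b)"
    have interior: "(bond_scattering G *v a) $ b = 2 / ?d * X - a $ bond_reverse b"
      if "\<not> exterior G v" "bond_start G b = v" for b
      using that by (auto simp: scattering_interior sum_bond_end X_def)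
    have sum: "(\<Sum>b | bond_start G b = v. end_normal l (bond_wave_deriv l k a) b) = 0" if "\<not> exterior G v"
    proof -
      have "(\<Sum>b | bond_start G b = v. end_normal l (bond_wave_deriv l k a) b)
          = (\<Sum>b | bond_start G b = v. \<i> * of_real k * (2 * a $ bond_reverse b - 2 / ?d * X))"
        by (intro sum.cong) (auto simp: end_normal_bond_wave out interior[OF that])
      also have "\<dots> = \<i> * of_real k * (2 * X - ?d * (2 / ?d * X))"
        by (simp add: sum_subtractf X_def degree_def flip: sum_distrib_left)
      also have "\<dots> = 0"
      \<comment> \<open>For d = 0 the fraction is 0 and nothing cancels, but then \<open>X\<close>
        is an empty sum.\<close>
      proof (cases "degree G v = 0")
        case True
        then have "{b. bond_start G b = v} = {}" by (simp add: degree_def)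
        then have "X = 0" unfolding X_def by (simp only: sum.empty)
        then show ?thesis by simp
      qed simp
      finally show ?thesis .
    qed
    have exterior: "case bc G v of Dirichlet \<Rightarrow> end_value l (bond_wave l k a) b = 0
        | Neumann \<Rightarrow> end_normal l (bond_wave_deriv l k a) b = 0" if "exterior G v" "bond_start G b = v" for b
      using that scattering_exterior[of G b a]
      by (cases "bc G v") (auto simp: end_value_bond_wave end_normal_bond_wave out)
    have continuous: "end_value l (bond_wave l k a) b = end_value l (bond_wave l k a) b'"
      if "\<not> exterior G v" "bond_start G b = v" "bond_start G b' = v" for b b'
      using that by (simp add: end_value_bond_wave out interior)
    show "if exterior G v
      then \<forall>b. bond_start G b = v \<longrightarrow>
        (case bc G v of Dirichlet \<Rightarrow> end_value l (bond_wave l k a) b = 0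
         | Neumann \<Rightarrow> end_normal l (bond_wave_deriv l k a) b = 0)
      else (\<forall>b b'. bond_start G b = v \<and> bond_start G b' = v \<longrightarrow>
          end_value l (bond_wave l k a) b = end_value l (bond_wave l k a) b') \<and>
        (\<Sum>b | bond_start G b = v. end_normal l (bond_wave_deriv l k a) b) = 0"
    proof (cases "exterior G v")
      case True
      then show ?thesis unfolding if_P[OF True] using exterior by blast
    next
      case False
      then show ?thesis unfolding if_not_P[OF False] using continuous sum by blast
    qed
  qed
qed

lemma bond_wave_eigenspace:
  fixes G :: "('v::finite, 'e::finite) qgraph"
  assumes "bond_evolution G (torus_class (k *\<^sub>R l)) *v a = a"
  shows "bond_wave l k a \<in> eigenspace G l (k\<^sup>2)"
proof -
  let ?u = "bond_wave l k a" and ?du = "bond_wave_deriv l k a"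
  have cont: "continuous_on S (?u e)" for S e
    by (rule continuous_on_vector_derivative) (rule has_vector_derivative_bond_wave)
  have cont': "continuous_on S (\<lambda>x. of_real (k\<^sup>2) * ?u e x)" for S e
    by (intro continuous_intros cont)
  have "?du e x = ?du e 0 - (LINT y:{0<..<x}|lborel. of_real (k\<^sup>2) * ?u e y)" if "x \<in> {0..l $ e}" for e x
  proof -
    have "((\<lambda>y. - (of_real (k\<^sup>2) * ?u e y)) has_integral (?du e x - ?du e 0)) {0..x}"
      using that by (intro fundamental_theorem_of_calculus has_vector_derivative_bond_wave_deriv) auto
    from integral_unique[OF has_integral_neg[OF this]]
    have "?du e x = ?du e 0 - integral {0..x} (\<lambda>y. of_real (k\<^sup>2) * ?u e y)"
      unfolding minus_minus by (simp only: minus_diff_eq diff_diff_eq2 add_diff_cancel_left')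
    then show ?thesis by (subst LINT_open_interval[OF cont'])
  qed
  moreover have "(\<lambda>e x. of_real (k\<^sup>2) * ?u e x) \<in> L2 l"
    by (intro L2_if_continuous cont')
  ultimately show ?thesis
    unfolding eigenspace_def neg_laplacian_def
    using has_vector_derivative_bond_wave vertex_conditions_bond_wave[OF assms] by blast
qed

section \<open>Green's formula and orthogonality of eigenspaces\<close>

lemma vertex_conditions_exterior:
  assumes "vertex_conditions G l u du" "exterior G (bond_start G b)"
  shows "case bc G (bond_start G b) of Dirichlet \<Rightarrow> end_value l u b = 0 | Neumann \<Rightarrow> end_normal l du b = 0"
  using spec[OF assms(1)[unfolded vertex_conditions_def], of "bond_start G b"]
  unfolding if_P[OF assms(2)] by blast

lemma vertex_conditions_interior:
  assumes "vertex_conditions G l u du" "\<not> exterior G v"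
  shows "bond_start G b = v \<Longrightarrow> bond_start G b' = v \<Longrightarrow> end_value l u b = end_value l u b'"
    and "(\<Sum>b | bond_start G b = v. end_normal l du b) = 0"
  using spec[OF assms(1)[unfolded vertex_conditions_def], of v]
  unfolding if_not_P[OF assms(2)] by blast+

text \<open>The boundary term of Green's formula vanishes vertex by vertex: at an exterior vertex
  one factor is 0, at an interior one the common value of w factors out of the total flux of
  u.\<close>

lemma vertex_conditions_pairing:
  fixes G :: "('v::finite, 'e::finite) qgraph"
  assumes "vertex_conditions G l u du" "vertex_conditions G l w dw"
  shows "(\<Sum>b\<in>UNIV. end_normal l du b * cnj (end_value l w b)) = 0"
proof -
  have "(\<Sum>b | bond_start G b = v. end_normal l du b * cnj (end_value l w b)) = 0" for v
  proof (cases "exterior G v")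
    case True
    then have "end_normal l du b * cnj (end_value l w b) = 0" if "bond_start G b = v" for b
      using vertex_conditions_exterior[OF assms(1), of b] vertex_conditions_exterior[OF assms(2), of b] that True
      by (cases "bc G v") auto
    then show ?thesis by (intro sum.neutral) simp
  next
    case False
    show ?thesis
    proof (cases "{b. bond_start G b = v} = {}")
      case nonempty: False
      then obtain b0 where b0: "bond_start G b0 = v" by auto
      have "end_value l w b = end_value l w b0" if "bond_start G b = v" for b
        by (rule vertex_conditions_interior(1)[OF assms(2) False that b0])
      then have "(\<Sum>b | bond_start G b = v. end_normal l du b * cnj (end_value l w b))
          = (\<Sum>b | bond_start G b = v. end_normal l du b) * cnj (end_value l w b0)"
        unfolding sum_distrib_right by (intro sum.cong) auto
      also have "\<dots> = 0" by (simp add: vertex_conditions_interior(2)[OF assms(1) False])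
      finally show ?thesis .
    qed (simp only: sum.empty)
  qed
  then have "(\<Sum>v\<in>UNIV. \<Sum>b | bond_start G b = v. end_normal l du b * cnj (end_value l w b)) = 0" by simp
  then show ?thesis
    using sum.group[of UNIV UNIV "bond_start G" "\<lambda>b. end_normal l du b * cnj (end_value l w b)"] by simp
qed

text \<open>The integrand \<mu> u is itself continuous, so the integral representation of the
  derivative can be differentiated at every point and the equation holds classically.\<close>

lemma eigenspace_derivatives:
  fixes G :: "('v::finite, 'e::finite) qgraph"
  assumes "u \<in> eigenspace G l \<mu>"
  shows "\<exists>du. vertex_conditions G l u du \<and> (\<forall>e. \<forall>x\<in>{0..l $ e}.
    (u e has_vector_derivative du e x) (at x within {0..l $ e}) \<and>
    (du e has_vector_derivative - (of_real \<mu> * u e x)) (at x within {0..l $ e}))"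
proof -
  obtain du where vc: "vertex_conditions G l u du"
    and deriv: "\<And>e x. x \<in> {0..l $ e} \<Longrightarrow> (u e has_vector_derivative du e x) (at x within {0..l $ e})"
    and du: "\<And>e x. x \<in> {0..l $ e} \<Longrightarrow> du e x = du e 0 - (LINT y:{0<..<x}|lborel. of_real \<mu> * u e y)"
    using assms unfolding eigenspace_def neg_laplacian_def by blast
  have "(du e has_vector_derivative - (of_real \<mu> * u e x)) (at x within {0..l $ e})"
    if x: "x \<in> {0..l $ e}" for e x
  proof -
    have cont: "continuous_on {0..l $ e} (\<lambda>y. of_real \<mu> * u e y)"
      by (intro continuous_intros continuous_on_vector_derivative[OF deriv])
    have "((\<lambda>x. du e 0 - integral {0..x} (\<lambda>y. of_real \<mu> * u e y))
        has_vector_derivative 0 - of_real \<mu> * u e x) (at x within {0..l $ e})"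
      by (intro has_vector_derivative_diff has_vector_derivative_const
          integral_has_vector_derivative[OF cont x])
    then have *: "((\<lambda>x. du e 0 - integral {0..x} (\<lambda>y. of_real \<mu> * u e y))
        has_vector_derivative - (of_real \<mu> * u e x)) (at x within {0..l $ e})" by simp
    show ?thesis
    proof (rule has_vector_derivative_transform[OF x _ *])
      fix y assume y: "y \<in> {0..l $ e}"
      then have "continuous_on {0..y} (\<lambda>y. of_real \<mu> * u e y)"
        by (intro continuous_on_subset[OF cont]) auto
      then show "du e y = du e 0 - integral {0..y} (\<lambda>y. of_real \<mu> * u e y)"
        using du[OF y] by (simp only: LINT_open_interval)
    qed
  qed
  then show ?thesis using vc deriv by blast
qed

lemma eigenspace_continuous:
  fixes G :: "('v::finite, 'e::finite) qgraph"
  assumes "u \<in> eigenspace G l \<mu>"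
  shows "continuous_on {0..l $ e} (u e)"
proof -
  obtain du where deriv: "\<And>x. x \<in> {0..l $ e} \<Longrightarrow> (u e has_vector_derivative du e x) (at x within {0..l $ e})"
    using eigenspace_derivatives[OF assms] by blast
  then show ?thesis by (intro continuous_on_vector_derivative[OF deriv])
qed

lemma eigenspace_orthogonal:
  fixes G :: "('v::finite, 'e::finite) qgraph"
  assumes u: "u \<in> eigenspace G l \<mu>" and w: "w \<in> eigenspace G l \<nu>" and "\<mu> \<noteq> \<nu>" and l: "\<And>e. l $ e > 0"
  shows "L2_inner l u w = 0"
proof -
  obtain du where du: "vertex_conditions G l u du"
    "\<And>e x. x \<in> {0..l $ e} \<Longrightarrow> (u e has_vector_derivative du e x) (at x within {0..l $ e})"
    "\<And>e x. x \<in> {0..l $ e} \<Longrightarrow> (du e has_vector_derivative - (of_real \<mu> * u e x)) (at x within {0..l $ e})"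
    using eigenspace_derivatives[OF u] by blast
  obtain dw where dw: "vertex_conditions G l w dw"
    "\<And>e x. x \<in> {0..l $ e} \<Longrightarrow> (w e has_vector_derivative dw e x) (at x within {0..l $ e})"
    "\<And>e x. x \<in> {0..l $ e} \<Longrightarrow> (dw e has_vector_derivative - (of_real \<nu> * w e x)) (at x within {0..l $ e})"
    using eigenspace_derivatives[OF w] by blast
  \<comment> \<open>Up to sign the Wronskian of u and the conjugate of w. Its derivative is \<nu> -
    \<mu> times u cnj w, both eigenvalues being real.\<close>
  define g where "g e x = du e x * cnj (w e x) - u e x * cnj (dw e x)" for e x
  have edge: "of_real (\<nu> - \<mu>) * (LINT x:{0<..<l $ e}|lborel. u e x * cnj (w e x)) = g e (l $ e) - g e 0" for e
  proof -
    have "((\<lambda>x. of_real (\<nu> - \<mu>) * (u e x * cnj (w e x))) has_integral g e (l $ e) - g e 0) {0..l $ e}"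
    proof (rule fundamental_theorem_of_calculus)
      fix x assume x: "x \<in> {0..l $ e}"
      have "(g e has_vector_derivative
          (du e x * cnj (dw e x) + - (of_real \<mu> * u e x) * cnj (w e x))
          - (u e x * cnj (- (of_real \<nu> * w e x)) + du e x * cnj (dw e x))) (at x within {0..l $ e})"
        unfolding g_def
        by (intro has_vector_derivative_diff has_vector_derivative_mult has_vector_derivative_cnj du dw x)
      then show "(g e has_vector_derivative of_real (\<nu> - \<mu>) * (u e x * cnj (w e x))) (at x within {0..l $ e})"
        by (simp add: algebra_simps)
    qed (use l[of e] in simp)
    then have "integral {0..l $ e} (\<lambda>x. of_real (\<nu> - \<mu>) * (u e x * cnj (w e x))) = g e (l $ e) - g e 0"
      by (rule integral_unique)
    moreover have "continuous_on {0..l $ e} (\<lambda>x. u e x * cnj (w e x))"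
      by (intro continuous_intros eigenspace_continuous[OF u] eigenspace_continuous[OF w])
    ultimately show ?thesis by (simp add: LINT_open_interval)
  qed
  have "of_real (\<nu> - \<mu>) * L2_inner l u w = (\<Sum>e\<in>UNIV. g e (l $ e) - g e 0)"
    unfolding L2_inner_def sum_distrib_left edge ..
  \<comment> \<open>The two ends of an edge are the starts of its two bonds; the outward sign in
    \<open>end_normal\<close> absorbs the minus sign at 0.\<close>
  also have "\<dots> = (\<Sum>e\<in>UNIV. \<Sum>s\<in>UNIV. end_normal l du (e, s) * cnj (end_value l w (e, s))
      - cnj (end_normal l dw (e, s) * cnj (end_value l u (e, s))))"
    by (intro sum.cong) (auto simp: UNIV_bool end_normal_def end_value_def g_def)
  also have "\<dots> = (\<Sum>b\<in>UNIV. end_normal l du b * cnj (end_value l w b)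
      - cnj (end_normal l dw b * cnj (end_value l u b)))"
    by (simp only: sum.cartesian_product UNIV_Times_UNIV split_def prod.collapse)
  also have "\<dots> = (\<Sum>b\<in>UNIV. end_normal l du b * cnj (end_value l w b))
      - cnj (\<Sum>b\<in>UNIV. end_normal l dw b * cnj (end_value l u b))"
    by (simp only: sum_subtractf cnj_sum)
  also have "\<dots> = 0"
    by (simp only: vertex_conditions_pairing[OF du(1) dw(1)] vertex_conditions_pairing[OF dw(1) du(1)]) simp
  finally show ?thesis using \<open>\<mu> \<noteq> \<nu>\<close> by simp
qed

section \<open>Evolution and observation of an eigenfunction\<close>

lemma spectral_calculus_eigenvector:
  fixes G :: "('v::finite, 'e::finite) qgraph"
  assumes u: "u \<in> eigenspace G l \<mu>" and nz: "L2_norm l u \<noteq> 0" and l: "\<And>e. l $ e > 0"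
  shows "spectral_calculus G l f u (\<lambda>e x. f \<mu> * u e x)"
proof -
  \<comment> \<open>A projection must be supplied at every real number, eigenvalue or not; away from
    \<mu> it is 0 by orthogonality.\<close>
  define p where "p \<nu> = (if \<nu> = \<mu> then u else (\<lambda>_ _. 0))" for \<nu>
  have "u \<in> L2 l" "(\<lambda>e x. f \<mu> * u e x) \<in> L2 l"
    by (intro L2_if_continuous continuous_intros eigenspace_continuous[OF u])+
  moreover have "eigenprojection G l \<nu> u (p \<nu>)" for \<nu>
  proof (cases "\<nu> = \<mu>")
    case True
    then show ?thesis using u by (simp add: eigenprojection_def p_def L2_inner_def)
  next
    case False
    have "(\<lambda>_ _. 0) \<in> eigenspace G l \<nu>"
      unfolding eigenspace_def neg_laplacian_def
    proof (intro CollectI conjI exI[of _ "\<lambda>_ _. 0"])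
      show "vertex_conditions G l (\<lambda>_ _. 0) (\<lambda>_ _. 0)"
      proof -
        have "end_value l (\<lambda>_ _. 0) b = 0" "end_normal l (\<lambda>_ _. 0) b = 0" for b
          by (simp_all add: end_value_def end_normal_def)
        then show ?thesis by (simp add: vertex_conditions_def split: bcond.split)
      qed
      show "(\<lambda>_ _. complex_of_real \<nu> * 0) \<in> L2 l"
        by (intro L2_if_continuous continuous_intros)
    qed simp
    moreover have "L2_inner l u \<phi> = 0" if "\<phi> \<in> eigenspace G l \<nu>" for \<phi>
      using False by (intro eigenspace_orthogonal[OF u that _ l]) auto
    ultimately show ?thesis using False by (simp add: eigenprojection_def p_def)
  qed
  moreover have "((\<lambda>F. L2_norm l (\<lambda>e x. f \<mu> * u e x - (\<Sum>\<nu>\<in>F. f \<nu> * p \<nu> e x))) \<longlongrightarrow> 0)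
      (finite_subsets_at_top (eigenvalues G l))"
  \<comment> \<open>Once a finite set contains \<mu> the partial sum is exact, so the net is
    eventually 0.\<close>
  proof (rule tendsto_eventually)
    have "\<mu> \<in> eigenvalues G l" using u nz by (auto simp: eigenvalues_def)
    moreover have "L2_norm l (\<lambda>e x. f \<mu> * u e x - (\<Sum>\<nu>\<in>F. f \<nu> * p \<nu> e x)) = 0" if "finite F" "\<mu> \<in> F" for F
    proof -
      have "(\<Sum>\<nu>\<in>F. f \<nu> * p \<nu> e x) = (\<Sum>\<nu>\<in>F. if \<nu> = \<mu> then f \<mu> * u e x else 0)" for e x
        by (intro sum.cong) (auto simp: p_def)
      then show ?thesis using that by (simp add: L2_norm_def)
    qed
    ultimately show "\<forall>\<^sub>F F in finite_subsets_at_top (eigenvalues G l).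
        L2_norm l (\<lambda>e x. f \<mu> * u e x - (\<Sum>\<nu>\<in>F. f \<nu> * p \<nu> e x)) = 0"
      unfolding eventually_finite_subsets_at_top by (intro exI[of _ "{\<mu>}"]) auto
  qed
  ultimately show ?thesis unfolding spectral_calculus_def by blast
qed

text \<open>The infimum is tested with the single competitor u. Unimodular factors leave the
  observed energy constant in time, whence the factor T.\<close>

lemma observability_constant_le:
  fixes G :: "('v::finite, 'e::finite) qgraph"
  assumes u: "u \<in> eigenspace G l \<mu>" and norm: "L2_norm l u = 1" and "\<mu> \<ge> 0" "T \<ge> 0"
    and l: "\<And>e. l $ e > 0"
  shows "observability_constant G l \<omega> T \<mu> \<le> ennreal T * observed_energy \<omega> u"
proof -
  define z where "z t = (\<lambda>e x. cis (- (t * \<mu>)) * u e x)" for t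
  have nz: "L2_norm l u \<noteq> 0" using norm by simp
  have "schroedinger_evolution G l u z"
    unfolding schroedinger_evolution_def z_def
    using spectral_calculus_eigenvector[OF u nz l, of "\<lambda>\<mu>. cis (- (t * \<mu>))" for t] by blast
  moreover have "spectral_calculus G l (indicator {0..\<mu>}) u u"
    using spectral_calculus_eigenvector[OF u nz l, of "indicator {0..\<mu>}"] \<open>\<mu> \<ge> 0\<close> by simp
  then have "u \<in> spectral_subspace G l \<mu>"
    unfolding spectral_subspace_def spectral_calculus_def by blast
  moreover have "(\<integral>\<^sup>+t\<in>{0..T}. observed_energy \<omega> (z t) \<partial>lborel) = ennreal T * observed_energy \<omega> u"
  proof -
    have "observed_energy \<omega> (z t) = observed_energy \<omega> u" for t
      by (simp add: observed_energy_def z_def norm_mult)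
    then show ?thesis
      using \<open>T \<ge> 0\<close> by (simp add: nn_integral_cmult_indicator mult.commute)
  qed
  ultimately show ?thesis
    unfolding observability_constant_def using norm
    by (intro Inf_lower CollectI exI[of _ u] exI[of _ z] conjI) (rule sym, assumption+)
qed

section \<open>Energy of bond waves\<close>

lemma sum_edge_intensity: "(\<Sum>e\<in>UNIV. edge_intensity a e) = (norm a)\<^sup>2"
proof -
  have "(\<Sum>e\<in>UNIV. edge_intensity a e) = (\<Sum>e\<in>UNIV. \<Sum>s\<in>UNIV. (cmod (a $ (e, s)))\<^sup>2)"
    by (simp add: edge_intensity_def UNIV_bool add.commute)
  also have "\<dots> = (norm a)\<^sup>2"
    by (simp only: sum.cartesian_product UNIV_Times_UNIV split_def prod.collapse norm_power2_vec)
  finally show ?thesis .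
qed

lemma continuous_bond_wave: "continuous_on S (bond_wave l k a e)"
  by (rule continuous_on_vector_derivative) (rule has_vector_derivative_bond_wave)

lemma cmod_bond_wave_le: "(cmod (bond_wave l k a e x))\<^sup>2 \<le> 2 * edge_intensity a e"
proof -
  let ?p = "cmod (a $ (e, True))" and ?q = "cmod (a $ (e, False))"
  have "cmod (bond_wave l k a e x) \<le> ?p + ?q"
    unfolding bond_wave_def by (rule order_trans[OF norm_triangle_ineq]) (simp add: norm_mult)
  then have "(cmod (bond_wave l k a e x))\<^sup>2 \<le> (?p + ?q)\<^sup>2" by (rule power_mono) simp
  also have "\<dots> \<le> 2 * (?p\<^sup>2 + ?q\<^sup>2)" using sum_squares_bound[of ?p ?q] by (simp add: power2_sum)
  finally show ?thesis by (simp add: edge_intensity_def)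
qed

text \<open>The squared modulus is the intensity plus a cross term oscillating with frequency 2 k.
  The antiderivative of the latter is at most half the intensity over k at each end, which together
  make the loss 1 / k.\<close>

lemma L2_bond_wave_ge:
  assumes "k > 0" "l $ e > 0"
  shows "(l $ e - 1 / k) * edge_intensity a e \<le> (LINT x:{0<..<l $ e}|lborel. (cmod (bond_wave l k a e x))\<^sup>2)"
proof -
  let ?A = "a $ (e, True)" and ?B = "a $ (e, False)" and ?L = "l $ e"
  define p where "p = ?A * cnj ?B"
  define F where "F x = edge_intensity a e * x + Im (p * cis (2 * k * x - k * ?L)) / k" for x
  have square: "(cmod (bond_wave l k a e x))\<^sup>2 = edge_intensity a e + 2 * Re (p * cis (2 * k * x - k * ?L))" for x
  proof -
    have cross: "?A * cis (k * (x - ?L)) * cnj (?B * cis (- (k * x))) = p * cis (2 * k * x - k * ?L)"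
      by (simp add: p_def cis_cnj cis_mult mult_ac) (simp add: cis_mult[symmetric] algebra_simps flip: mult.assoc)
    have "(cmod (z + w))\<^sup>2 = (cmod z)\<^sup>2 + (cmod w)\<^sup>2 + 2 * Re (z * cnj w)" for z w
      unfolding power2_norm_eq_inner by (simp add: inner_complex_def algebra_simps)
    then show ?thesis
      by (simp only: bond_wave_def edge_intensity_def norm_mult norm_cis mult_1_right cross)
  qed
  have "((\<lambda>x. (cmod (bond_wave l k a e x))\<^sup>2) has_integral F ?L - F 0) {0..?L}"
  proof (rule fundamental_theorem_of_calculus)
    fix x
    have "(F has_real_derivative edge_intensity a e + 2 * Re (p * cis (2 * k * x - k * ?L))) (at x)"
    proof -
      have "((\<lambda>x. edge_intensity a e * x + (Re p * sin (2 * k * x - k * ?L) + Im p * cos (2 * k * x - k * ?L)) / k)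
          has_real_derivative edge_intensity a e * 1
            + (Re p * (cos (2 * k * x - k * ?L) * (2 * k)) + Im p * (- sin (2 * k * x - k * ?L) * (2 * k))) / k) (at x)"
        by (intro DERIV_add DERIV_cmult DERIV_ident DERIV_cdivide DERIV_fun_sin DERIV_fun_cos)
          (auto intro!: derivative_eq_intros)
      moreover have "(Re p * (cos (2 * k * x - k * ?L) * (2 * k)) + Im p * (- sin (2 * k * x - k * ?L) * (2 * k))) / k
          = 2 * Re (p * cis (2 * k * x - k * ?L))"
        using \<open>k > 0\<close> by (simp add: field_simps)
      ultimately show ?thesis by (simp add: F_def[abs_def])
    qed
    then show "(F has_vector_derivative (cmod (bond_wave l k a e x))\<^sup>2) (at x within {0..?L})"
      unfolding square has_real_derivative_iff_has_vector_derivative by (rule has_vector_derivative_at_within)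
  qed (use assms in simp)
  then have "(LINT x:{0<..<?L}|lborel. (cmod (bond_wave l k a e x))\<^sup>2) = F ?L - F 0"
    by (subst LINT_open_interval) (auto intro!: continuous_intros continuous_bond_wave integral_unique)
  also have "\<dots> = edge_intensity a e * ?L + (Im (p * cis (2 * k * ?L - k * ?L)) - Im (p * cis (2 * k * 0 - k * ?L))) / k"
    by (simp only: F_def diff_divide_distrib mult_zero_right add_0_left add_diff_eq)
  also have "\<dots> \<ge> edge_intensity a e * ?L + (- edge_intensity a e) / k"
  proof (intro add_left_mono divide_right_mono)
    have "\<bar>Im (p * cis t)\<bar> \<le> edge_intensity a e / 2" for t
    proof -
      have "\<bar>Im (p * cis t)\<bar> \<le> cmod (p * cis t)" by (rule abs_Im_le_cmod)
      also have "\<dots> = cmod ?A * cmod ?B" by (simp add: p_def norm_mult)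
      also have "\<dots> \<le> edge_intensity a e / 2"
        using sum_squares_bound[of "cmod ?A" "cmod ?B"] by (simp add: edge_intensity_def)
      finally show ?thesis .
    qed
    from this[of "2 * k * ?L - k * ?L"] this[of "2 * k * 0 - k * ?L"]
    show "- edge_intensity a e \<le> Im (p * cis (2 * k * ?L - k * ?L)) - Im (p * cis (2 * k * 0 - k * ?L))"
      by linarith
  qed (use assms in simp)
  finally show ?thesis by (simp add: algebra_simps)
qed

text \<open>For k \<ge> 2 / m the oscillating part costs at most m / 2 on each edge. The bound is
  uniform in k, so normalising an eigenfunction inflates its part outside K by a bounded factor
  only.\<close>

lemma L2_norm_bond_wave_ge:
  fixes l :: "real ^ 'e::finite"
  assumes "m > 0" "\<And>e. m \<le> l $ e" "2 / m \<le> k"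
  shows "m / 2 * (norm a)\<^sup>2 \<le> (L2_norm l (bond_wave l k a))\<^sup>2"
proof -
  have "0 < 2 / m" using \<open>m > 0\<close> by simp
  then have "k > 0" using assms(3) by linarith
  have half: "m / 2 \<le> l $ e - 1 / k" for e
  proof -
    have "1 / k \<le> m / 2" using assms(1,3) \<open>k > 0\<close> by (simp add: field_simps)
    then show ?thesis using assms(2)[of e] by linarith
  qed
  have "m / 2 * (norm a)\<^sup>2 = (\<Sum>e\<in>UNIV. m / 2 * edge_intensity a e)"
    unfolding sum_edge_intensity[symmetric] sum_distrib_left ..
  also have "\<dots> \<le> (\<Sum>e\<in>UNIV. LINT x:{0<..<l $ e}|lborel. (cmod (bond_wave l k a e x))\<^sup>2)"
  proof (rule sum_mono)
    fix e
    have "m / 2 * edge_intensity a e \<le> (l $ e - 1 / k) * edge_intensity a e"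
      by (intro mult_right_mono half) (simp add: edge_intensity_def)
    also have "\<dots> \<le> (LINT x:{0<..<l $ e}|lborel. (cmod (bond_wave l k a e x))\<^sup>2)"
      using \<open>k > 0\<close> assms(1) assms(2)[of e] by (intro L2_bond_wave_ge) auto
    finally show "m / 2 * edge_intensity a e \<le> (LINT x:{0<..<l $ e}|lborel. (cmod (bond_wave l k a e x))\<^sup>2)" .
  qed
  also have "\<dots> = (L2_norm l (bond_wave l k a))\<^sup>2"
    unfolding L2_norm_def
    by (subst real_sqrt_pow2) (auto intro!: sum_nonneg simp: set_lebesgue_integral_def)
  finally show ?thesis .
qed

lemma observed_energy_bond_wave_le:
  fixes l :: "real ^ 'e::finite"
  assumes "open_in_edges l \<omega>" "\<not> meets K \<omega>" "\<And>e. l $ e > 0"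
  shows "observed_energy \<omega> (bond_wave l k a) \<le> ennreal (2 * norm l * (\<Sum>e\<in>- K. edge_intensity a e))"
proof -
  have edge: "(\<integral>\<^sup>+x\<in>\<omega> e. ennreal ((cmod (bond_wave l k a e x))\<^sup>2) \<partial>lborel)
      \<le> ennreal (if e \<in> K then 0 else 2 * norm l * edge_intensity a e)" for e
  proof (cases "e \<in> K")
    case True
    then show ?thesis using assms(2) by (simp add: meets_def)
  next
    case False
    have \<omega>: "\<omega> e \<subseteq> {0<..<l $ e}" "\<omega> e \<in> sets lborel"
      using assms(1) by (auto simp: open_in_edges_def)
    have "(\<integral>\<^sup>+x\<in>\<omega> e. ennreal ((cmod (bond_wave l k a e x))\<^sup>2) \<partial>lborel)
        \<le> (\<integral>\<^sup>+x\<in>\<omega> e. ennreal (2 * edge_intensity a e) \<partial>lborel)"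
      by (intro nn_integral_mono mult_right_mono ennreal_leI cmod_bond_wave_le) auto
    also have "\<dots> = ennreal (2 * edge_intensity a e) * emeasure lborel (\<omega> e)"
      by (rule nn_integral_cmult_indicator) fact
    also have "\<dots> \<le> ennreal (2 * edge_intensity a e) * emeasure lborel {0<..<l $ e}"
      by (intro mult_left_mono emeasure_mono \<omega>) auto
    also have "\<dots> = ennreal (2 * edge_intensity a e * l $ e)"
      using assms(3)[of e] by (simp add: ennreal_mult edge_intensity_def)
    also have "\<dots> \<le> ennreal (2 * edge_intensity a e * norm l)"
      using component_le_norm_cart[of l e]
      by (intro ennreal_leI mult_left_mono) (auto simp: edge_intensity_def)
    finally show ?thesis using False by (simp add: mult_ac)
  qed
  have "observed_energy \<omega> (bond_wave l k a) \<le> (\<Sum>e\<in>UNIV. ennreal (if e \<in> K then 0 else 2 * norm l * edge_intensity a e))"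
    unfolding observed_energy_def by (intro sum_mono edge)
  also have "\<dots> = ennreal (\<Sum>e\<in>UNIV. if e \<in> K then 0 else 2 * norm l * edge_intensity a e)"
    by (rule sum_ennreal) (auto simp: edge_intensity_def)
  also have "(\<Sum>e\<in>UNIV. if e \<in> K then 0 else 2 * norm l * edge_intensity a e)
      = 2 * norm l * (\<Sum>e\<in>- K. edge_intensity a e)"
    unfolding sum_distrib_left by (rule sum.mono_neutral_cong_right) auto
  finally show ?thesis .
qed

text \<open>In the application b is a multiple of the resonant eigenvector. As b vanishes off K, the
  intensity of a there equals that of a - b, at most \<delta>^2 times the total; the lower bound on
  the L2 norm converts this into energy.\<close>

lemma resonant_frequency:
  fixes G :: "('v::finite, 'e::finite) qgraph"
  assumes l: "m > 0" "\<And>e. m \<le> l $ e" and "2 / m \<le> k"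
    and \<omega>: "open_in_edges l \<omega>" "\<not> meets K \<omega>"
    and a: "bond_evolution G (torus_class (k *\<^sub>R l)) *v a = a" "a \<noteq> 0"
    and b: "\<And>e. e \<notin> K \<Longrightarrow> edge_intensity b e = 0"
    and close: "norm (a - b) \<le> \<delta> * norm a"
  shows "k\<^sup>2 \<in> eigenvalues G l"
    and "T \<ge> 0 \<Longrightarrow> observability_constant G l \<omega> T (k\<^sup>2) \<le> ennreal (T * (4 * norm l / m * \<delta>\<^sup>2))"
proof -
  have l_pos: "l $ e > 0" for e using l(1) l(2)[of e] by linarith
  define N where "N = L2_norm l (bond_wave l k a)"
  have N_ge: "m / 2 * (norm a)\<^sup>2 \<le> N\<^sup>2"
    unfolding N_def using l \<open>2 / m \<le> k\<close> by (rule L2_norm_bond_wave_ge)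
  moreover have "0 < m / 2 * (norm a)\<^sup>2" using l(1) a(2) by simp
  ultimately have "N \<noteq> 0" by auto
  moreover have "N \<ge> 0" unfolding N_def L2_norm_def
    by (auto intro!: sum_nonneg simp: set_lebesgue_integral_def)
  ultimately have N: "N > 0" by simp
  show "k\<^sup>2 \<in> eigenvalues G l"
    unfolding eigenvalues_def using bond_wave_eigenspace[OF a(1)] N
    by (intro CollectI bexI[of _ "bond_wave l k a"]) (auto simp: N_def)
  show "observability_constant G l \<omega> T (k\<^sup>2) \<le> ennreal (T * (4 * norm l / m * \<delta>\<^sup>2))" if "T \<ge> 0"
  proof -
    define a' where "a' = complex_of_real (1 / N) *s a"
    have fixed: "bond_evolution G (torus_class (k *\<^sub>R l)) *v a' = a'"
      by (simp add: a'_def vector_scalar_commute a(1))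
    have wave: "bond_wave l k a' e x = complex_of_real (1 / N) * bond_wave l k a e x" for e x
      by (simp add: bond_wave_def a'_def algebra_simps)
    have "L2_norm l (bond_wave l k a') = 1 / N * N"
    proof -
      have "(LINT x:{0<..<l $ e}|lborel. (cmod (bond_wave l k a' e x))\<^sup>2)
          = (1 / N)\<^sup>2 * (LINT x:{0<..<l $ e}|lborel. (cmod (bond_wave l k a e x))\<^sup>2)" for e
        unfolding wave norm_mult power_mult_distrib norm_of_real power2_abs
        by (rule set_integral_mult_right)
      then have "L2_norm l (bond_wave l k a')
          = sqrt ((1 / N)\<^sup>2 * (\<Sum>e\<in>UNIV. LINT x:{0<..<l $ e}|lborel. (cmod (bond_wave l k a e x))\<^sup>2))"
        by (simp only: L2_norm_def sum_distrib_left)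
      also have "\<dots> = 1 / N * N"
        using N unfolding real_sqrt_mult by (simp add: N_def L2_norm_def)
      finally show ?thesis .
    qed
    then have "observability_constant G l \<omega> T (k\<^sup>2) \<le> ennreal T * observed_energy \<omega> (bond_wave l k a')"
      using N \<open>T \<ge> 0\<close> l_pos by (intro observability_constant_le bond_wave_eigenspace fixed) auto
    also have "\<dots> \<le> ennreal T * ennreal (2 * norm l * (\<Sum>e\<in>- K. edge_intensity a' e))"
      by (intro mult_left_mono observed_energy_bond_wave_le \<omega> l_pos) auto
    also have "\<dots> = ennreal (T * (2 * norm l * (\<Sum>e\<in>- K. edge_intensity a' e)))"
      using \<open>T \<ge> 0\<close> by (simp add: ennreal_mult' sum_nonneg edge_intensity_def)
    also have "\<dots> \<le> ennreal (T * (4 * norm l / m * \<delta>\<^sup>2))"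
    proof (intro ennreal_leI mult_left_mono \<open>T \<ge> 0\<close>)
      have "(\<Sum>e\<in>- K. edge_intensity a e) = (\<Sum>e\<in>- K. edge_intensity (a - b) e)"
      proof (rule sum.cong)
        fix e assume "e \<in> - K"
        then have "edge_intensity b e = 0" using b by simp
        then have "b $ (e, True) = 0" "b $ (e, False) = 0"
          by (simp_all add: edge_intensity_def add_nonneg_eq_0_iff)
        then show "edge_intensity a e = edge_intensity (a - b) e" by (simp add: edge_intensity_def)
      qed simp
      also have "\<dots> \<le> (\<Sum>e\<in>UNIV. edge_intensity (a - b) e)"
        by (intro sum_mono2) (auto simp: edge_intensity_def)
      also have "\<dots> = (norm (a - b))\<^sup>2" by (rule sum_edge_intensity)
      also have "\<dots> \<le> (\<delta> * norm a)\<^sup>2" by (intro power_mono close) simp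
      also have "\<dots> \<le> \<delta>\<^sup>2 * (2 / m * N\<^sup>2)"
        using N_ge l(1) unfolding power_mult_distrib by (intro mult_left_mono) (auto simp: field_simps)
      finally have "(\<Sum>e\<in>- K. edge_intensity a e) / N\<^sup>2 \<le> \<delta>\<^sup>2 * (2 / m * N\<^sup>2) / N\<^sup>2"
        by (rule divide_right_mono) simp
      also have "\<dots> = \<delta>\<^sup>2 * (2 / m)" using N by simp
      also have "(\<Sum>e\<in>- K. edge_intensity a e) / N\<^sup>2 = (\<Sum>e\<in>- K. edge_intensity a' e)"
        by (simp add: edge_intensity_def a'_def norm_mult norm_divide power_divide sum_divide_distrib add_divide_distrib)
      finally have "(\<Sum>e\<in>- K. edge_intensity a' e) \<le> \<delta>\<^sup>2 * (2 / m)" .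
      then have "2 * norm l * (\<Sum>e\<in>- K. edge_intensity a' e) \<le> 2 * norm l * (\<delta>\<^sup>2 * (2 / m))"
        by (intro mult_left_mono) auto
      then show "2 * norm l * (\<Sum>e\<in>- K. edge_intensity a' e) \<le> 4 * norm l / m * \<delta>\<^sup>2"
        by (simp add: mult_ac)
    qed
    finally show ?thesis .
  qed
qed

section \<open>Approximation in the length torus\<close>

lemma simple_resonance_eigenvector:
  fixes G :: "('v::finite, 'e::finite) qgraph"
  assumes "\<theta> \<in> simple_resonances G K"
  shows "\<exists>a. norm a = 1 \<and> bond_evolution G \<theta> *v a = a \<and> (\<forall>e. e \<notin> K \<longrightarrow> edge_intensity a e = 0) \<and>
    (\<forall>x. bond_evolution G \<theta> *v x = x \<longrightarrow> (\<exists>c. x = c *s a))"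
proof -
  let ?E = "{x. bond_evolution G \<theta> *v x = x}"
  obtain b where b: "b \<noteq> 0" "bond_evolution G \<theta> *v b = b" "\<And>e. edge_intensity b e > 0 \<longleftrightarrow> e \<in> K"
    and dim: "vec.dim ?E = 1"
    using assms unfolding simple_resonances_def by blast
  define a where "a = complex_of_real (1 / norm b) *s b"
  have "norm a = 1" using b(1) by (simp add: a_def norm_mult_vec norm_divide)
  moreover have fixed: "bond_evolution G \<theta> *v a = a"
    by (simp add: a_def vector_scalar_commute b(2))
  moreover have "edge_intensity a e = 0" if "e \<notin> K" for e
  proof -
    have "edge_intensity b e = 0"
      using b(3)[of e] that by (simp add: edge_intensity_def not_less sum_power2_le_zero_iff)
    then show ?thesis by (simp add: edge_intensity_def a_def norm_mult add_nonneg_eq_0_iff)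
  qed
  moreover have "\<exists>c. x = c *s a" if "bond_evolution G \<theta> *v x = x" for x
  proof -
    have "a \<noteq> 0" using \<open>norm a = 1\<close> by auto
    \<comment> \<open>A nonzero vector is an independent set with as many elements as the dimension,
      hence it spans.\<close>
    then have "?E \<subseteq> vec.span {a}"
      using fixed dim by (intro vec.card_ge_dim_independent) auto
    then show ?thesis using that by (auto simp: vec.span_singleton)
  qed
  ultimately show ?thesis by blast
qed

lemma torus_class_add: "torus_class (x + y) = torus_class x * torus_class y"
  by (simp add: torus_class_def vec_eq_iff cis_mult)

lemma torus_class_in_torus: "torus_class x \<in> torus"
  by (simp add: torus_class_def torus_def)

lemma torus_eq_range: "torus = range torus_class"
proof (intro equalityI subsetI)
  fix z :: "complex ^ 'n" assume z: "z \<in> torus"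
  have "z $ i = cis (Arg (z $ i))" for i
  proof -
    have "cmod (z $ i) = 1" using z by (simp add: torus_def)
    moreover from this have "z $ i \<noteq> 0" by force
    ultimately show ?thesis by (simp add: cis_Arg sgn_eq)
  qed
  then have "z = torus_class (\<chi> i. Arg (z $ i))" by (simp add: torus_class_def vec_eq_iff)
  then show "z \<in> range torus_class" by blast
qed (auto simp: torus_class_in_torus)

text \<open>The density is established in the intrinsic coordinates, where \<theta> is the image of
  some [x] because \<Xi> is onto. The integer matrix A of \<Xi> acts linearly on lifts and carries
  deviations back with a bounded factor; \<phi> is the lift A x of \<theta>.\<close>

lemma length_torus_approximation:
  fixes l :: "real ^ 'e::finite" and \<beta> :: "real ^ 'r::finite"
  assumes iso: "lattice_isomorphism l \<Xi>"
    and flow: "\<And>t. \<Xi> (torus_class (t *\<^sub>R \<beta>)) = torus_class (t *\<^sub>R l)"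
    and dioph: "\<gamma> > 0" "\<tau> > 0" "diophantine \<gamma> \<tau> \<beta>"
    and \<theta>: "\<theta> \<in> length_torus l"
  shows "\<exists>\<phi>. torus_class \<phi> = \<theta> \<and> (\<exists>C>0. \<forall>t0 P. P \<ge> (1::nat) \<longrightarrow>
    (\<exists>t\<ge>t0. t \<le> t0 + C * real P powr \<tau> \<and>
      (\<exists>y. norm y \<le> C / real P \<and> torus_class (t *\<^sub>R l) = torus_class (\<phi> + y))))"
proof -
  obtain \<Psi> M where \<Psi>: "homeomorphism torus (length_torus l) \<Xi> \<Psi>"
    and M: "\<And>x. \<Xi> (torus_class x) = torus_class ((\<chi> e. of_int_vec (M $ e)) *v x)"
    using iso unfolding lattice_isomorphism_def by blast
  define A where "A = (\<chi> e. of_int_vec (M $ e))"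
  have "\<theta> \<in> \<Xi> ` torus" using \<Psi> \<theta> by (simp add: homeomorphism_def)
  then obtain x where x: "\<theta> = \<Xi> (torus_class x)" unfolding torus_eq_range by blast
  obtain C0 where C0: "C0 > 0"
    "\<And>t0 P. P \<ge> (1::nat) \<Longrightarrow> \<exists>t\<ge>t0. t \<le> t0 + C0 * real P powr \<tau> \<and>
       (\<Sum>j\<in>UNIV. (cmod (1 - cis (t * \<beta> $ j - x $ j)))\<^sup>2) \<le> C0 / (real P)\<^sup>2"
    using diophantine_flow_dense[OF dioph] by blast
  obtain L where L: "L > 0" "\<And>y. norm (A *v y) \<le> norm y * L"
    using bounded_linear.pos_bounded[OF matrix_vector_mul_bounded_linear[of A]] by blast
  define C where "C = C0 + 2 * sqrt C0 * L"
  have C: "C0 \<le> C" "2 * sqrt C0 * L \<le> C" "C > 0" using C0(1) L(1) by (auto simp: C_def add_pos_nonneg)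
  have "\<exists>t\<ge>t0. t \<le> t0 + C * real P powr \<tau> \<and>
      (\<exists>z. norm z \<le> C / real P \<and> torus_class (t *\<^sub>R l) = torus_class (A *v x + z))"
    if P: "P \<ge> (1::nat)" for t0 P
  proof -
    obtain t where t: "t0 \<le> t" "t \<le> t0 + C0 * real P powr \<tau>"
      "(\<Sum>j\<in>UNIV. (cmod (1 - cis (t * \<beta> $ j - x $ j)))\<^sup>2) \<le> C0 / (real P)\<^sup>2"
      using C0(2)[OF P] by blast
    \<comment> \<open>The representative of t \<beta> - x modulo 2 \<pi> with entries in the
      principal interval, where the chord controls the angle.\<close>
    define y where "y = (\<chi> j. Arg (cis (t * \<beta> $ j - x $ j)))"
    have cis_y: "cis (y $ j) = cis (t * \<beta> $ j - x $ j)" for j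
      by (simp add: y_def cis_Arg sgn_eq)
    have "(norm y)\<^sup>2 = (\<Sum>j\<in>UNIV. (y $ j)\<^sup>2)"
      by (simp add: norm_vec_def L2_set_def sum_nonneg)
    also have "\<dots> \<le> (\<Sum>j\<in>UNIV. 4 * (cmod (1 - cis (t * \<beta> $ j - x $ j)))\<^sup>2)"
    proof (rule sum_mono)
      fix j
      have "\<bar>y $ j\<bar> \<le> pi"
        using mpi_less_Arg[of "cis (t * \<beta> $ j - x $ j)"] Arg_le_pi[of "cis (t * \<beta> $ j - x $ j)"]
        by (simp add: y_def abs_le_iff)
      then have "\<bar>y $ j\<bar> \<le> 2 * cmod (1 - cis (t * \<beta> $ j - x $ j))"
        using abs_le_norm_one_minus_cis[of "y $ j"] by (simp only: cis_y)
      then have "\<bar>y $ j\<bar>\<^sup>2 \<le> (2 * cmod (1 - cis (t * \<beta> $ j - x $ j)))\<^sup>2" by (rule power_mono) simp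
      then show "(y $ j)\<^sup>2 \<le> 4 * (cmod (1 - cis (t * \<beta> $ j - x $ j)))\<^sup>2" by (simp add: power_mult_distrib)
    qed
    also have "\<dots> = 4 * (\<Sum>j\<in>UNIV. (cmod (1 - cis (t * \<beta> $ j - x $ j)))\<^sup>2)" by (simp only: sum_distrib_left)
    also have "\<dots> \<le> 4 * (C0 / (real P)\<^sup>2)" using t(3) by (rule mult_left_mono) simp
    also have "\<dots> = (2 * sqrt C0 / real P)\<^sup>2" using C0(1) by (simp add: power_divide power_mult_distrib)
    finally have "norm y \<le> 2 * sqrt C0 / real P" by (rule power2_le_imp_le) (use C0(1) in simp)
    then have "norm (A *v y) \<le> 2 * sqrt C0 / real P * L"
      using L(2)[of y] L(1) by (meson mult_right_mono less_imp_le order_trans)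
    also have "\<dots> = (2 * sqrt C0 * L) / real P" by simp
    also have "\<dots> \<le> C / real P" using C(2) by (rule divide_right_mono) simp
    finally have "norm (A *v y) \<le> C / real P" .
    moreover have "torus_class (t *\<^sub>R l) = torus_class (A *v x + A *v y)"
    proof -
      have "torus_class (t *\<^sub>R \<beta>) = torus_class (x + y)"
        unfolding torus_class_add by (simp add: torus_class_def vec_eq_iff cis_y) (simp add: cis_mult)
      then have "torus_class (t *\<^sub>R l) = torus_class (A *v (x + y))"
        using flow[of t] M[of "x + y"] by (simp add: A_def)
      then show ?thesis by (simp add: matrix_vector_right_distrib)
    qed
    moreover have "C0 * real P powr \<tau> \<le> C * real P powr \<tau>" using C(1) by (rule mult_right_mono) simp
    then have "t \<le> t0 + C * real P powr \<tau>" using t(2) by linarith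
    ultimately show "\<exists>t\<ge>t0. t \<le> t0 + C * real P powr \<tau> \<and>
      (\<exists>z. norm z \<le> C / real P \<and> torus_class (t *\<^sub>R l) = torus_class (A *v x + z))"
      using t(1) by blast
  qed
  moreover have "torus_class (A *v x) = \<theta>" by (simp add: x M A_def)
  ultimately show ?thesis using C(3) by blast
qed

section \<open>Choice of the frequencies and final bounds\<close>

lemma ennreal_inverse_antimono:
  fixes x y :: ennreal
  assumes "x \<le> y"
  shows "inverse y \<le> inverse x"
  using assms including ennreal.lifting by transfer (rule ereal_inverse_antimono)

theorem corollary7p3:
  fixes G :: "('v::finite, 'e::finite) qgraph"
    and l :: "real ^ 'e"
    and \<omega> :: "'e \<Rightarrow> real set"
    and K :: "'e set"
    and \<Xi> :: "complex ^ 'r::finite \<Rightarrow> complex ^ 'e"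
    and \<beta> :: "real ^ 'r"
    and \<gamma> \<tau> :: real
  assumes "graph_connected G"
    and "\<And>e. l $ e > 0"
    and "open_in_edges l \<omega>" and "\<exists>e. \<omega> e \<noteq> {}"
    and "\<not> GGCC G \<omega>"
    and "proper_primitive_subgraph G K" and "\<not> meets K \<omega>"
    and "RAC G K l"
    and "CARD('r) = length_torus_dim l" and "length_torus_dim l \<ge> 2"
    and "lattice_isomorphism l \<Xi>"
    and "\<And>t. \<Xi> (torus_class (t *\<^sub>R \<beta>)) = torus_class (t *\<^sub>R l)"
    and "\<gamma> > 0" and "\<tau> > real (length_torus_dim l) - 1"
    and "diophantine \<gamma> \<tau> \<beta>"
  shows "\<exists>(C::real) (c::real) (k :: nat \<Rightarrow> real).
    C > 0 \<and> c > 0 \<and> filterlim k at_top sequentially \<and>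
    (\<forall>n. k n > 0 \<and> (k n)\<^sup>2 \<in> eigenvalues G l) \<and>
    (\<forall>T>0. \<forall>n.
      observability_constant G l \<omega> T ((k n)\<^sup>2) \<le> ennreal (C * T * ((k n)\<^sup>2) powr (- 1 / \<tau>)) \<and>
      inverse (observability_constant G l \<omega> T ((k n)\<^sup>2)) \<ge> ennreal (c * inverse T * ((k n)\<^sup>2) powr (1 / \<tau>)))"
proof -
  \<comment> \<open>Dimension at least 2 enters here: with \<tau> > 1, P is at most
    \<open>real P powr \<tau>\<close>, so that lower bounds on P pass to k.\<close>
  have \<tau>: "1 < \<tau>" using assms(10,14) by linarith
  obtain \<theta> where \<theta>: "\<theta> \<in> length_torus l" "\<theta> \<in> simple_resonances G K"
    using \<open>RAC G K l\<close> unfolding RAC_def by blast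
  obtain a where a: "norm a = 1" "bond_evolution G \<theta> *v a = a" "\<And>e. e \<notin> K \<Longrightarrow> edge_intensity a e = 0"
    "\<And>x. bond_evolution G \<theta> *v x = x \<Longrightarrow> \<exists>c. x = c *s a"
    using simple_resonance_eigenvector[OF \<theta>(2)] by blast
  have torus: "\<theta> \<in> torus" using \<theta>(2) by (simp add: simple_resonances_def secular_set_def)
  obtain C1 \<delta> where "C1 > 0" "\<delta> > 0"
    and resonance: "\<And>y. norm y \<le> \<delta> \<Longrightarrow> \<exists>s x. \<bar>s\<bar> \<le> C1 * norm y \<and>
      x \<noteq> 0 \<and> phase_mult (y + s *\<^sub>R l) (bond_evolution G \<theta> *v x) = x"
    and near: "\<And>\<psi> x. phase_mult \<psi> (bond_evolution G \<theta> *v x) = x \<Longrightarrow>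
      \<exists>c. norm (x - c *s a) \<le> C1 * norm \<psi> * norm x"
    using resonance_perturbation[OF hermitian_inner_bond_evolution[OF torus] a(2,1,4) assms(2)] by blast
  have "\<tau> > 0" using \<tau> by simp
  obtain \<phi> C2 where \<phi>: "torus_class \<phi> = \<theta>" and "C2 > 0"
    and approx: "\<And>t0 P. P \<ge> (1::nat) \<Longrightarrow> \<exists>t\<ge>t0. t \<le> t0 + C2 * real P powr \<tau> \<and>
      (\<exists>y. norm y \<le> C2 / real P \<and> torus_class (t *\<^sub>R l) = torus_class (\<phi> + y))"
    using length_torus_approximation[OF assms(11,12,13) \<open>\<tau> > 0\<close> assms(15) \<theta>(1)] by blast
  define m where "m = Min (range (($) l))"
  have m: "m > 0" "m \<le> l $ e" for e using assms(2) by (auto simp: m_def)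
  \<comment> \<open>\<open>D / real P\<close> will bound the relative distance of the eigenvector to
    the line of \<open>a\<close>, and \<open>E\<close> the ratio of k to
    \<open>real P powr \<tau>\<close>.\<close>
  define D where "D = C1 * (C2 * (1 + C1 * norm l))"
  define E where "E = 1 + 2 * (C1 * C2) + C2"
  have "D > 0" "E > 0"
    using \<open>C1 > 0\<close> \<open>C2 > 0\<close> by (auto simp: D_def E_def intro!: mult_pos_pos add_pos_nonneg)
  have frequency: "\<exists>k. real P powr \<tau> \<le> k \<and> k \<le> E * real P powr \<tau> \<and> k\<^sup>2 \<in> eigenvalues G l \<and>
      (\<forall>T\<ge>0. observability_constant G l \<omega> T (k\<^sup>2) \<le> ennreal (T * (4 * norm l / m * (D / real P)\<^sup>2)))"
    if P: "P \<ge> 1" "2 / m \<le> real P" "C2 / \<delta> \<le> real P" for P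
  proof -
    have P_pos: "0 < real P" using P(1) by simp
    have P_powr: "1 \<le> real P powr \<tau>" "real P \<le> real P powr \<tau>"
      using P(1) \<tau> powr_mono[of 1 \<tau> "real P"] by (auto simp: ge_one_powr_ge_zero)
    \<comment> \<open>The window starts C1 * C2 late because the correction s may be negative, of at
      most this size; k thus stays above \<open>real P powr \<tau>\<close>.\<close>
    obtain t y where t: "real P powr \<tau> + C1 * C2 \<le> t" "t \<le> real P powr \<tau> + C1 * C2 + C2 * real P powr \<tau>"
      and y: "norm y \<le> C2 / real P" "torus_class (t *\<^sub>R l) = torus_class (\<phi> + y)"
      using approx[OF P(1), of "real P powr \<tau> + C1 * C2"] by blast
    have "C2 / real P \<le> \<delta>" using P(3) P_pos \<open>\<delta> > 0\<close> by (simp add: field_simps)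
    then have "norm y \<le> \<delta>" using y(1) by linarith
    then obtain s x where s: "\<bar>s\<bar> \<le> C1 * norm y" and x: "x \<noteq> 0" "phase_mult (y + s *\<^sub>R l) (bond_evolution G \<theta> *v x) = x"
      using resonance by blast
    have "C1 * norm y \<le> C1 * (C2 / real P)" using y(1) \<open>C1 > 0\<close> by (intro mult_left_mono) auto
    then have s_le: "\<bar>s\<bar> \<le> C1 * (C2 / real P)" using s by linarith
    also have "\<dots> \<le> C1 * C2"
      using P(1) \<open>C1 > 0\<close> \<open>C2 > 0\<close> by (simp add: field_simps)
    finally have s_le': "\<bar>s\<bar> \<le> C1 * C2" .
    define k where "k = t + s"
    have k_ge: "real P powr \<tau> \<le> k" using t(1) s_le' by (simp add: k_def)
    have "C1 * C2 * 1 \<le> C1 * C2 * real P powr \<tau>"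
      using P_powr \<open>C1 > 0\<close> \<open>C2 > 0\<close> by (intro mult_left_mono) auto
    then have k_le: "k \<le> E * real P powr \<tau>"
      using t(2) s_le' by (simp add: k_def E_def distrib_right)
    have "torus_class (k *\<^sub>R l) = torus_class (\<phi> + (y + s *\<^sub>R l))"
      unfolding k_def scaleR_left_distrib torus_class_add y(2) by (simp only: mult.assoc)
    then have fixed: "bond_evolution G (torus_class (k *\<^sub>R l)) *v x = x"
      by (simp only: bond_evolution_torus_class_add \<phi> x)
    obtain c where c: "norm (x - c *s a) \<le> C1 * norm (y + s *\<^sub>R l) * norm x" using near[OF x(2)] by blast
    have "norm (y + s *\<^sub>R l) \<le> norm y + \<bar>s\<bar> * norm l" using norm_triangle_ineq[of y "s *\<^sub>R l"] by simp
    also have "\<dots> \<le> C2 / real P + C1 * (C2 / real P) * norm l"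
      using y(1) s_le by (intro add_mono mult_right_mono) auto
    finally have "C1 * norm (y + s *\<^sub>R l) \<le> C1 * (C2 / real P + C1 * (C2 / real P) * norm l)"
      using \<open>C1 > 0\<close> by simp
    also have "\<dots> = D / real P" by (simp add: D_def distrib_left add_divide_distrib mult_ac)
    finally have "C1 * norm (y + s *\<^sub>R l) \<le> D / real P" .
    from order_trans[OF c mult_right_mono[OF this norm_ge_zero]]
    have "norm (x - c *s a) \<le> D / real P * norm x" .
    moreover have "2 / m \<le> k" using P(2) P_powr(2) k_ge by linarith
    moreover have "edge_intensity (c *s a) e = 0" if "e \<notin> K" for e
      using a(3)[OF that] by (simp add: edge_intensity_def norm_mult add_nonneg_eq_0_iff)
    ultimately have "k\<^sup>2 \<in> eigenvalues G l"
      "T \<ge> 0 \<Longrightarrow> observability_constant G l \<omega> T (k\<^sup>2) \<le> ennreal (T * (4 * norm l / m * (D / real P)\<^sup>2))" for T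
      using resonant_frequency[OF m _ assms(3,7) fixed x(1)] by blast+
    then show ?thesis using k_ge k_le by blast
  qed
  obtain P0 :: nat where P0: "1 \<le> P0" "2 / m \<le> real P0" "C2 / \<delta> \<le> real P0"
    using real_arch_simple[of "max 1 (max (2 / m) (C2 / \<delta>))"] by auto
  have "\<forall>n. \<exists>k. real (n + P0) powr \<tau> \<le> k \<and> k \<le> E * real (n + P0) powr \<tau> \<and> k\<^sup>2 \<in> eigenvalues G l \<and>
      (\<forall>T\<ge>0. observability_constant G l \<omega> T (k\<^sup>2) \<le> ennreal (T * (4 * norm l / m * (D / real (n + P0))\<^sup>2)))"
  proof
    fix n
    have "real P0 \<le> real (n + P0)" by simp
    then show "\<exists>k. real (n + P0) powr \<tau> \<le> k \<and> k \<le> E * real (n + P0) powr \<tau> \<and> k\<^sup>2 \<in> eigenvalues G l \<and>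
        (\<forall>T\<ge>0. observability_constant G l \<omega> T (k\<^sup>2) \<le> ennreal (T * (4 * norm l / m * (D / real (n + P0))\<^sup>2)))"
      using P0 by (intro frequency) linarith+
  qed
  then obtain k where k: "\<And>n. real (n + P0) powr \<tau> \<le> k n" "\<And>n. k n \<le> E * real (n + P0) powr \<tau>"
    "\<And>n. (k n)\<^sup>2 \<in> eigenvalues G l"
    "\<And>n T. T \<ge> 0 \<Longrightarrow> observability_constant G l \<omega> T ((k n)\<^sup>2) \<le> ennreal (T * (4 * norm l / m * (D / real (n + P0))\<^sup>2))"
    by metis
  \<comment> \<open>The last factor is the price of trading P for k: as k is at most
    \<open>E * real P powr \<tau>\<close>, 1 / P^2 is at most this factor times
    \<open>k powr (- (2 / \<tau>))\<close>.\<close>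
  define C where "C = 4 * norm l / m * D\<^sup>2 * E powr (2 / \<tau>)"
  have "norm l > 0" using assms(2) by (metis order_less_irrefl zero_index zero_less_norm_iff)
  then have "C > 0" using m(1) \<open>D > 0\<close> \<open>E > 0\<close> by (simp add: C_def)
  have k_pos: "k n > 0" for n
    using k(1)[of n] P0(1) by (smt (verit) of_nat_0_less_iff powr_gt_zero add_gr_0 less_le_trans zero_less_one)
  have bound: "observability_constant G l \<omega> T ((k n)\<^sup>2) \<le> ennreal (C * T * ((k n)\<^sup>2) powr (- 1 / \<tau>))" if "T > 0" for T n
  proof -
    let ?P = "real (n + P0)"
    have P: "0 < ?P" using P0(1) by simp
    have "k n powr (2 / \<tau>) \<le> (E * ?P powr \<tau>) powr (2 / \<tau>)"
      using k(2)[of n] k_pos[of n] \<open>\<tau> > 0\<close> by (intro powr_mono2) auto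
    also have "\<dots> = E powr (2 / \<tau>) * ?P\<^sup>2"
      using \<open>E > 0\<close> P \<open>\<tau> > 0\<close> by (simp add: powr_mult powr_powr)
    finally have "1 / ?P\<^sup>2 \<le> E powr (2 / \<tau>) * k n powr (- (2 / \<tau>))"
      using P k_pos[of n] by (simp add: powr_minus field_simps)
    also have "k n powr (- (2 / \<tau>)) = ((k n)\<^sup>2) powr (- 1 / \<tau>)"
      using k_pos[of n] by (simp add: powr_powr flip: powr_numeral)
    finally have "(4 * norm l / m * D\<^sup>2) * (1 / ?P\<^sup>2) \<le> (4 * norm l / m * D\<^sup>2) * (E powr (2 / \<tau>) * ((k n)\<^sup>2) powr (- 1 / \<tau>))"
      using m(1) by (intro mult_left_mono) auto
    then have "4 * norm l / m * (D / ?P)\<^sup>2 \<le> C * ((k n)\<^sup>2) powr (- 1 / \<tau>)"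
      by (simp add: C_def power_divide mult.assoc)
    then have "T * (4 * norm l / m * (D / ?P)\<^sup>2) \<le> T * (C * ((k n)\<^sup>2) powr (- 1 / \<tau>))"
      using \<open>T > 0\<close> by (intro mult_left_mono) auto
    then have "ennreal (T * (4 * norm l / m * (D / ?P)\<^sup>2)) \<le> ennreal (C * T * ((k n)\<^sup>2) powr (- 1 / \<tau>))"
      by (intro ennreal_leI) (simp only: mult_ac)
    then show ?thesis using k(4)[of T n] \<open>T > 0\<close> by (meson less_imp_le order_trans)
  qed
  \<comment> \<open>With c = 1 / C the claimed lower bound is the exact inverse of the upper bound
    just shown, which is positive and finite.\<close>
  have "ennreal (1 / C * inverse T * ((k n)\<^sup>2) powr (1 / \<tau>)) \<le> inverse (observability_constant G l \<omega> T ((k n)\<^sup>2))"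
    if "T > 0" for T n
  proof -
    have pos: "0 < C * T * ((k n)\<^sup>2) powr (- 1 / \<tau>)" using \<open>C > 0\<close> \<open>T > 0\<close> k_pos[of n] by simp
    have "((k n)\<^sup>2) powr (1 / \<tau>) = inverse (((k n)\<^sup>2) powr (- 1 / \<tau>))"
      using powr_minus[of "(k n)\<^sup>2" "1 / \<tau>"] by (simp only: inverse_inverse_eq minus_divide_left)
    then have "1 / C * inverse T * ((k n)\<^sup>2) powr (1 / \<tau>) = inverse (C * T * ((k n)\<^sup>2) powr (- 1 / \<tau>))"
      by (simp only: inverse_mult_distrib divide_inverse[of 1 C] mult_1)
    then have "ennreal (1 / C * inverse T * ((k n)\<^sup>2) powr (1 / \<tau>)) = inverse (ennreal (C * T * ((k n)\<^sup>2) powr (- 1 / \<tau>)))"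
      by (simp only: inverse_ennreal[OF pos])
    also have "\<dots> \<le> inverse (observability_constant G l \<omega> T ((k n)\<^sup>2))"
      using bound[OF that] by (rule ennreal_inverse_antimono)
    finally show ?thesis .
  qed
  moreover have "filterlim k at_top sequentially"
  proof (rule filterlim_at_top_mono[OF filterlim_real_sequentially])
    have "real n \<le> k n" for n
    proof -
      have "real n \<le> real (n + P0) powr 1" by simp
      also have "\<dots> \<le> real (n + P0) powr \<tau>" using P0(1) \<tau> by (intro powr_mono) auto
      also have "\<dots> \<le> k n" by (rule k(1))
      finally show ?thesis .
    qed
    then show "\<forall>\<^sub>F n in sequentially. real n \<le> k n" by simp
  qed
  moreover have "0 < 1 / C" using \<open>C > 0\<close> by simp
  ultimately show ?thesis
    using \<open>C > 0\<close> k_pos k(3) bound by (intro exI[of _ C] exI[of _ "1 / C"] exI[of _ k] conjI allI impI) auto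
qed

end
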